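(* There exist a piecewise expanding map $f:[0,1]\to[0,1]$ with $\lambda_f>1$ (that is, $f\in H_1$) having periodic turning points, and a family $(Q_\varepsilon)_{\varepsilon>0}$ of smooth random perturbations which is small, local and satisfies the regularity assumption, such that for all sufficiently small $\varepsilon>0$ the perturbed system $f_\varepsilon$ has a unique invariant SBR measure $\mu_\varepsilon$, and $\mu_\varepsilon$ converges weakly, as $\varepsilon\to0$, to a singular and unstable invariant measure of $f$.
   Context: $X=[0,1]$, $m$ is Lebesgue measure; $\operatorname{var}(h)$ is the total variation over $\mathbb R$ of $h$ extended by $0$ outside $X$. Piecewise expanding (PE) map: $f:X\to X$ such that there is a finite partition of $X$ into disjoint intervals $X_j$ for which $f|_{X_j}$ extends to a $C^2$-diffeomorphism from $\mathrm{Clos}(X_j)$ onto its image, with $\lambda_f:=\inf_{j,\,x\in X_j}|f'(x)|>0$ and $\lambda_{f^\kappa}>1$ for some iterate $f^\kappa$. $H_1$ is the class of PE maps with $\lambda_f>1$. A turning point is a point of $X$ at which the derivative of $f$ is not well defined; a periodic turning point is a turning point that is periodic under $f$. Random perturbations: transition probabilities $Q_\varepsilon(x,A)$ on $X$, acting on densities by $\int_AQ_\varepsilon h\,dm=\int h(x)Q_\varepsilon(x,A)\,dm(x)$. They are smooth if they have transition densities, $Q_\varepsilon(x,A)=\int_A q_\varepsilon(x,y)\,dm(y)$. Small: $\|Q_\varepsilon h-h\|_1\to0$ as $\varepsilon\to0$ for all $h\in L^1$. Local: $Q_\varepsilon(x,A)=0$ whenever $\operatorname{dist}(x,A)>\varepsilon$.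 (Here $\varepsilon$ may be taken up to a fixed constant factor.) Regularity: $\operatorname{var}(Q_\varepsilon h)\le\operatorname{var}(h)+C\|h\|_1$ for all $h$ of bounded variation, with $C$ independent of $\varepsilon$. $f_\varepsilon$ is the Markov process with transition probabilities $Q_\varepsilon(fx,A)$; $f_\varepsilon\mu(A)=\int Q_\varepsilon(fx,A)\,d\mu(x)$; $\mu$ is $f_\varepsilon$-invariant if $f_\varepsilon\mu=\mu$. A probability measure $\mu_\varepsilon$ is an SBR measure of $f_\varepsilon$ if there is an open $U\subseteq X$ such that $f_\varepsilon^n\mu\to\mu_\varepsilon$ weakly for every probability measure $\mu$ with a Lebesgue density and support in $U$. A measure is singular if it is singular with respect to Lebesgue measure; an invariant measure is called unstable here if it is carried by an unstable (repelling) periodic orbit of $f$. *)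

theory Defs
  imports "HOL-Probability.Probability"
begin

abbreviation unit_ivl :: "real set" where
  "unit_ivl \<equiv> {0..1}"

text \<open>Lebesgue measure on the unit interval, on its Borel sets. It also serves as the
  measurable space underlying \<^const>\<open>prob_algebra\<close>, whose elements are then the Borel
  probability measures on the unit interval.\<close>

abbreviation leb :: "real measure" where
  "leb \<equiv> restrict_space lborel unit_ivl"


subsection \<open>Piecewise expanding maps\<close>

definition C2_on :: "real set \<Rightarrow> (real \<Rightarrow> real) \<Rightarrow> bool" where
  "C2_on S g \<longleftrightarrow>
     (\<exists>g' g''. (\<forall>x\<in>S. (g has_real_derivative g' x) (at x within S)) \<and>
               (\<forall>x\<in>S. (g' has_real_derivative g'' x) (at x within S)) \<and>
               continuous_on S g'')"

definition C2_diffeo_onto_image :: "real set \<Rightarrow> (real \<Rightarrow> real) \<Rightarrow> bool" where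
  "C2_diffeo_onto_image S g \<longleftrightarrow>
     C2_on S g \<and> (\<exists>h. C2_on (g ` S) h \<and> (\<forall>x\<in>S. h (g x) = x))"

text \<open>Intervals consisting of a single point are not excluded here: the common refinement that
  belongs to an iterate of a piecewise expanding map may contain some. They are excluded for the
  map itself in \<open>piecewise_expanding\<close> and \<open>H1\<close>.\<close>

definition pe_partition :: "(real \<Rightarrow> real) \<Rightarrow> real set set \<Rightarrow> bool" where
  "pe_partition f P \<longleftrightarrow>
     finite P \<and> partition_on unit_ivl P \<and>
     (\<forall>J\<in>P. is_interval J \<and>
        (\<exists>g. C2_diffeo_onto_image (closure J) g \<and> (\<forall>x\<in>J. g x = f x)))"

definition nondegenerate :: "real set set \<Rightarrow> bool" where
  "nondegenerate P \<longleftrightarrow> (\<forall>J\<in>P. interior J \<noteq> {})"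

text \<open>The derivative is that of the restriction of \<open>f\<close> to the partition interval, hence one-sided
  at its end points; single points carry no derivative and are skipped. For all partitions
  satisfying \<open>pe_partition f P\<close> the value is the same, by continuity of the derivatives
  of the extended branches.\<close>

definition min_expansion :: "real set set \<Rightarrow> (real \<Rightarrow> real) \<Rightarrow> real" where
  "min_expansion P f =
     Inf {\<bar>vector_derivative f (at x within J)\<bar> | J x. J \<in> P \<and> interior J \<noteq> {} \<and> x \<in> J}"

definition piecewise_expanding :: "(real \<Rightarrow> real) \<Rightarrow> bool" where
  "piecewise_expanding f \<longleftrightarrow>
     f \<in> unit_ivl \<rightarrow> unit_ivl \<and>
     (\<exists>P. pe_partition f P \<and> nondegenerate P \<and> min_expansion P f > 0) \<and>
     (\<exists>\<kappa>\<ge>1. \<exists>P. pe_partition (f ^^ \<kappa>) P \<and> min_expansion P (f ^^ \<kappa>) > 1)"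

definition H1 :: "(real \<Rightarrow> real) \<Rightarrow> bool" where
  "H1 f \<longleftrightarrow>
     piecewise_expanding f \<and>
     (\<exists>P. pe_partition f P \<and> nondegenerate P \<and> min_expansion P f > 1)"

text \<open>At the end points 0 and 1 the one-sided derivative counts, so that they are not
  turning points automatically.\<close>

definition turning_point :: "(real \<Rightarrow> real) \<Rightarrow> real \<Rightarrow> bool" where
  "turning_point f c \<longleftrightarrow> c \<in> unit_ivl \<and> \<not> f differentiable (at c within unit_ivl)"

definition periodic_with :: "(real \<Rightarrow> real) \<Rightarrow> nat \<Rightarrow> real \<Rightarrow> bool" where
  "periodic_with f n p \<longleftrightarrow> p \<in> unit_ivl \<and> n \<ge> 1 \<and> (f ^^ n) p = p"

definition periodic_turning_point :: "(real \<Rightarrow> real) \<Rightarrow> real \<Rightarrow> bool" where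
  "periodic_turning_point f c \<longleftrightarrow> turning_point f c \<and> (\<exists>n. periodic_with f n c)"


subsection \<open>Variation\<close>

definition pointwise_variation :: "(real \<Rightarrow> real) \<Rightarrow> ennreal" where
  "pointwise_variation g =
     (SUP (n, t) \<in> {(n::nat, t::nat \<Rightarrow> real). mono t}. \<Sum>i<n. ennreal \<bar>g (t (Suc i)) - g (t i)\<bar>)"

text \<open>Total variation over the whole line of the extension of \<open>h\<close> by 0. Since it is applied to
  elements of \<open>L\<^sup>1\<close>, the infimum over all representatives is taken.\<close>

definition var :: "(real \<Rightarrow> real) \<Rightarrow> ennreal" where
  "var h = (INF g \<in> {g. AE x in lborel. g x = (if x \<in> unit_ivl then h x else 0)}.
              pointwise_variation g)"

definition norm1 :: "(real \<Rightarrow> real) \<Rightarrow> real" where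
  "norm1 h = (LINT x|leb. \<bar>h x\<bar>)"


subsection \<open>Random perturbations\<close>

definition transition_prob :: "(real \<Rightarrow> real measure) \<Rightarrow> bool" where
  "transition_prob Q \<longleftrightarrow> Q \<in> leb \<rightarrow>\<^sub>M prob_algebra leb"

definition smooth_kernel :: "(real \<Rightarrow> real measure) \<Rightarrow> bool" where
  "smooth_kernel Q \<longleftrightarrow>
     (\<exists>q. case_prod q \<in> borel_measurable (leb \<Otimes>\<^sub>M leb) \<and>
          (\<forall>x\<in>unit_ivl. \<forall>A\<in>sets leb. emeasure (Q x) A = (\<integral>\<^sup>+y\<in>A. q x y \<partial>leb)))"

text \<open>The action on \<open>L\<^sup>1\<close>. The condition determines the function up to null sets, and all uses
  below depend on its class only.\<close>

definition kernel_op :: "(real \<Rightarrow> real measure) \<Rightarrow> (real \<Rightarrow> real) \<Rightarrow> real \<Rightarrow> real" where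
  "kernel_op Q h =
     (SOME k. integrable leb k \<and>
        (\<forall>A\<in>sets leb. (LINT y:A|leb. k y) = (LINT x|leb. h x * measure (Q x) A)))"

definition small_perturbation :: "(real \<Rightarrow> real \<Rightarrow> real measure) \<Rightarrow> bool" where
  "small_perturbation Q \<longleftrightarrow>
     (\<forall>h. integrable leb h \<longrightarrow>
        ((\<lambda>\<epsilon>. norm1 (\<lambda>x. kernel_op (Q \<epsilon>) h x - h x)) \<longlongrightarrow> 0) (at_right 0))"

definition local_perturbation :: "(real \<Rightarrow> real \<Rightarrow> real measure) \<Rightarrow> bool" where
  "local_perturbation Q \<longleftrightarrow>
     (\<forall>\<epsilon>>0. \<forall>x\<in>unit_ivl. \<forall>A\<in>sets leb. infdist x A > \<epsilon> \<longrightarrow> emeasure (Q \<epsilon> x) A = 0)"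

definition regular_perturbation :: "(real \<Rightarrow> real \<Rightarrow> real measure) \<Rightarrow> bool" where
  "regular_perturbation Q \<longleftrightarrow>
     (\<exists>C\<ge>0. \<forall>\<epsilon>>0. \<forall>h. integrable leb h \<longrightarrow> var h < \<infinity> \<longrightarrow>
        var (kernel_op (Q \<epsilon>) h) \<le> var h + ennreal (C * norm1 h))"


subsection \<open>The perturbed system\<close>

text \<open>\<open>perturbed f Q \<mu> A\<close> is the integral of \<open>Q (f x) A\<close> with respect to \<open>\<mu>\<close>.\<close>

definition perturbed ::
  "(real \<Rightarrow> real) \<Rightarrow> (real \<Rightarrow> real measure) \<Rightarrow> real measure \<Rightarrow> real measure" where
  "perturbed f Q \<mu> = Giry_Monad.bind \<mu> (\<lambda>x. Q (f x))"

definition weakly_tendsto :: "('i \<Rightarrow> real measure) \<Rightarrow> real measure \<Rightarrow> 'i filter \<Rightarrow> bool" where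
  "weakly_tendsto \<mu>s \<mu> F \<longleftrightarrow>
     (\<forall>\<phi>::real \<Rightarrow> real. continuous_on unit_ivl \<phi> \<longrightarrow>
        ((\<lambda>i. LINT x|\<mu>s i. \<phi> x) \<longlongrightarrow> (LINT x|\<mu>. \<phi> x)) F)"

definition SBR_measure ::
  "(real \<Rightarrow> real) \<Rightarrow> (real \<Rightarrow> real measure) \<Rightarrow> real measure \<Rightarrow> bool" where
  "SBR_measure f Q \<nu> \<longleftrightarrow>
     \<nu> \<in> space (prob_algebra leb) \<and>
     (\<exists>U. openin (top_of_set unit_ivl) U \<and> U \<noteq> {} \<and>
        (\<forall>\<mu> \<in> space (prob_algebra leb).
           (\<exists>\<rho> \<in> borel_measurable leb. \<mu> = density leb \<rho>) \<and> (AE x in \<mu>. x \<in> U) \<longrightarrow>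
           weakly_tendsto (\<lambda>n. (perturbed f Q ^^ n) \<mu>) \<nu> sequentially))"

definition invariant_SBR_measure ::
  "(real \<Rightarrow> real) \<Rightarrow> (real \<Rightarrow> real measure) \<Rightarrow> real measure \<Rightarrow> bool" where
  "invariant_SBR_measure f Q \<nu> \<longleftrightarrow> SBR_measure f Q \<nu> \<and> perturbed f Q \<nu> = \<nu>"


subsection \<open>Invariant measures of the map\<close>

definition invariant_measure :: "(real \<Rightarrow> real) \<Rightarrow> real measure \<Rightarrow> bool" where
  "invariant_measure f \<mu> \<longleftrightarrow> \<mu> \<in> space (prob_algebra leb) \<and> distr \<mu> leb f = \<mu>"

definition singular_measure :: "real measure \<Rightarrow> bool" where
  "singular_measure \<mu> \<longleftrightarrow>
     (\<exists>N\<in>sets leb. emeasure leb N = 0 \<and> emeasure \<mu> (unit_ivl - N) = 0)"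

definition orbit_of :: "(real \<Rightarrow> real) \<Rightarrow> real \<Rightarrow> real set" where
  "orbit_of f p = range (\<lambda>k. (f ^^ k) p)"

text \<open>The orbit may pass through turning points, where the derivative of the iterate does not
  exist; hence repulsion is expressed by a local expansion inequality. It holds on both sides of
  every point of the orbit.\<close>

definition repelling_periodic :: "(real \<Rightarrow> real) \<Rightarrow> nat \<Rightarrow> real \<Rightarrow> bool" where
  "repelling_periodic f n p \<longleftrightarrow>
     periodic_with f n p \<and>
     (\<forall>z \<in> orbit_of f p. \<exists>L>1. \<exists>\<delta>>0. \<forall>x\<in>unit_ivl.
        \<bar>x - z\<bar> < \<delta> \<longrightarrow> \<bar>(f ^^ n) x - z\<bar> \<ge> L * \<bar>x - z\<bar>)"

definition unstable_measure :: "(real \<Rightarrow> real) \<Rightarrow> real measure \<Rightarrow> bool" where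
  "unstable_measure f \<mu> \<longleftrightarrow>
     invariant_measure f \<mu> \<and>
     (\<exists>n p. repelling_periodic f n p \<and> (AE x in \<mu>. x \<in> orbit_of f p))"

end

theory Submission
  imports Defs
begin

text \<open>The map \<open>x \<mapsto> 1 - 2 * x\<close> on \<open>[0,1/3)\<close>, continued by doubling on \<open>[1/3,1]\<close> (after rescaling), has the
  repelling fixed turning point \<open>1/3\<close> and takes no values below it. The perturbation averages
  over the cells of a grid with \<open>3 * N\<close> cells and then, with probability \<open>1\<close> to the right of \<open>1/3\<close>,
  shifts by one cell to the left. The two cells adjacent to \<open>1/3\<close> then form a trap: the folding
  map sends each of them over the two cells to the right of \<open>1/3\<close>, and the shift moves these
  exactly back onto the trap. For \<open>N = 2 ^ m\<close> every cell reaches the trap in \<open>m + 1\<close> steps with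
  probability at least \<open>(1/2) ^ (m + 1)\<close>, so that all initial distributions converge to
  the uniform distribution on the trap, which tends to the point mass at \<open>1/3\<close>.

  Cell averages do not increase the variation. Left of \<open>1/3\<close> the shift takes place with a probability
  that decreases linearly to \<open>0\<close>; this slow variation costs only a multiple of the \<open>L\<^sup>1\<close> norm and keeps
  the mass inside the interval.\<close>

subsection \<open>The map\<close>

text \<open>The factor 1 in front of \<open>var h\<close> in the regularity assumption is the
  obstacle: the noise cannot simply concentrate mass near the turning point, but averaging,
  translating and a slowly varying mixture of the two are harmless. At a repelling fixed point where
  the map is monotone with slope 2, two cells would be spread over four, and no translation could
  bring them back. The fold overlays the images of both sides, so two cells again cover only two.
  The factor 3 in the number of cells puts 1/3 and 2/3 on the grid. Every half of a cell is then
  mapped affinely onto a whole cell, so that the perturbed system, seen through cell averages, is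
  exactly a finite Markov chain. Convergence is proved on the side of observables: integrals against
  the evolved measure become integrals of iterates of a transition operator, and a contraction
  uniform over the states handles all initial measures at once. The choice N = 2 ^ m makes 2 ^ (m +
  1) a multiple of 2 * N, so m + 1 doublings modulo 2 * N annihilate every offset from the turning
  point.\<close>

definition wmap :: "real \<Rightarrow> real" where
  "wmap x = (if x < 1/3 then 1 - 2*x else if x < 2/3 then 2*x - 1/3 else 2*x - 1)"

definition wpieces :: "real set set" where
  "wpieces = {{0..<1/3}, {1/3..<2/3}, {2/3..1}}"

lemma C2_diffeo_affine:
  fixes a b :: real
  assumes "a \<noteq> 0"
  shows "C2_diffeo_onto_image S (\<lambda>x. a * x + b)"
proof -
  have C2: "C2_on T (\<lambda>x. r * x + s)" for T and r s :: real
    unfolding C2_on_def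
    by (intro exI[of _ "\<lambda>_. r"] exI[of _ "\<lambda>_. 0"]) (auto intro!: derivative_eq_intros)
  have "\<forall>x\<in>S. (1/a) * (a * x + b) + (- b/a) = x"
    using assms by (auto simp: field_simps)
  then show ?thesis
    unfolding C2_diffeo_onto_image_def using C2[of S a b] C2[of "(\<lambda>x. a * x + b) ` S" "1/a" "-b/a"]
    by blast
qed

lemma wpieces_affine:
  assumes "J \<in> wpieces"
  obtains a b where "\<bar>a\<bar> = 2" "\<And>x. x \<in> J \<Longrightarrow> wmap x = a * x + b"
proof -
  have "\<exists>a b. \<bar>a\<bar> = 2 \<and> (\<forall>x\<in>J. wmap x = a * x + b)"
    using assms unfolding wpieces_def
  proof (elim insertE emptyE)
    assume "J = {0..<1/3}"
    then show ?thesis by (intro exI[of _ "-2"] exI[of _ 1]) (auto simp: wmap_def)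
  next
    assume "J = {1/3..<2/3}"
    then show ?thesis by (intro exI[of _ 2] exI[of _ "-1/3"]) (auto simp: wmap_def)
  next
    assume "J = {2/3..1}"
    then show ?thesis by (intro exI[of _ 2] exI[of _ "-1"]) (auto simp: wmap_def)
  qed
  then show ?thesis using that by blast
qed

lemma wpieces_interval:
  assumes "J \<in> wpieces"
  obtains a b where "a < b" "{a<..<b} \<subseteq> J" "J \<subseteq> {a..b}" "is_interval J"
proof -
  have "\<exists>a b. a < b \<and> {a<..<b} \<subseteq> J \<and> J \<subseteq> {a..b} \<and> is_interval J"
    using assms unfolding wpieces_def
  proof (elim insertE emptyE)
    assume "J = {0..<1/3}"
    then show ?thesis by (intro exI[of _ 0] exI[of _ "1/3"]) auto
  next
    assume "J = {1/3..<2/3}"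
    then show ?thesis by (intro exI[of _ "1/3"] exI[of _ "2/3"]) auto
  next
    assume "J = {2/3..1}"
    then show ?thesis by (intro exI[of _ "2/3"] exI[of _ 1]) auto
  qed
  then show ?thesis using that by blast
qed

lemma wmap_partition: "pe_partition wmap wpieces"
  unfolding pe_partition_def
proof (intro conjI ballI)
  show "finite wpieces" by (simp add: wpieces_def)
  show "partition_on unit_ivl wpieces"
    by (rule partition_onI) (auto simp: wpieces_def disjnt_def)
  fix J assume J: "J \<in> wpieces"
  show "is_interval J" by (rule wpieces_interval[OF J])
  obtain a b where ab: "\<bar>a\<bar> = 2" "\<And>x. x \<in> J \<Longrightarrow> wmap x = a * x + b"
    using wpieces_affine[OF J] by blast
  then have "C2_diffeo_onto_image (closure J) (\<lambda>x. a * x + b)"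
    by (intro C2_diffeo_affine) auto
  with ab(2) show "\<exists>g. C2_diffeo_onto_image (closure J) g \<and> (\<forall>x\<in>J. g x = wmap x)"
    by (intro exI[of _ "\<lambda>x. a * x + b"]) auto
qed

lemma wpieces_interior:
  assumes "J \<in> wpieces"
  shows "interior J \<noteq> {}"
proof -
  obtain a b where ab: "a < b" "{a<..<b} \<subseteq> J"
    using wpieces_interval[OF assms] by metis
  then have "{a<..<b} \<subseteq> interior J" by (simp add: interior_maximal)
  with ab(1) show ?thesis by (metis greaterThanLessThan_empty_iff leD subset_empty)
qed

lemma wmap_derivative:
  assumes J: "J \<in> wpieces" and x: "x \<in> J"
  shows "\<bar>vector_derivative wmap (at x within J)\<bar> = 2"
proof -
  obtain a b where ab: "\<bar>a\<bar> = 2" "\<And>x. x \<in> J \<Longrightarrow> wmap x = a * x + b"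
    using wpieces_affine[OF J] by blast
  obtain l r where lr: "l < r" "{l<..<r} \<subseteq> J" "J \<subseteq> {l..r}"
    using wpieces_interval[OF J] by metis
  have "x \<in> {l..r}" using lr x by auto
  \<comment> \<open>A derivative within \<open>J\<close> is determined only at limit points of
    \<open>J\<close>; nondegeneracy of the piece provides this even at its end points.\<close>
  then have "x islimpt {l<..<r}"
    by (metis closure_greaterThanLessThan islimpt_Icc limpt_of_closure lr(1))
  then have "at x within J \<noteq> bot"
    using islimpt_subset[OF _ lr(2)] by (simp add: trivial_limit_within)
  moreover have "((\<lambda>x. a * x + b) has_vector_derivative a) (at x within J)"
    by (auto intro!: derivative_eq_intros simp: has_real_derivative_iff_has_vector_derivative[symmetric])
  then have "(wmap has_vector_derivative a) (at x within J)"
    by (rule has_vector_derivative_transform[OF x, rotated]) (simp add: ab)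
  ultimately show ?thesis
    using ab(1) by (simp add: vector_derivative_within)
qed

lemma wmap_expansion: "min_expansion wpieces wmap = 2"
proof -
  have "{\<bar>vector_derivative wmap (at x within J)\<bar> | J x.
          J \<in> wpieces \<and> interior J \<noteq> {} \<and> x \<in> J} = {2}"
  proof (intro equalityI subsetI)
    fix y :: real assume "y \<in> {2}"
    moreover have "{0..<1/3} \<in> wpieces" "(0::real) \<in> {0..<1/3}" by (auto simp: wpieces_def)
    ultimately show "y \<in> {\<bar>vector_derivative wmap (at x within J)\<bar> | J x.
          J \<in> wpieces \<and> interior J \<noteq> {} \<and> x \<in> J}"
      using wmap_derivative wpieces_interior by fastforce
  qed (auto simp: wmap_derivative)
  then show ?thesis by (simp add: min_expansion_def)
qed

lemma wmap_unit: "wmap \<in> unit_ivl \<rightarrow> unit_ivl"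
  by (auto simp: wmap_def)

lemma H1_wmap: "H1 wmap"
proof -
  have "nondegenerate wpieces"
    by (simp add: nondegenerate_def wpieces_interior)
  then show ?thesis
    unfolding H1_def piecewise_expanding_def
    using wmap_unit wmap_partition wmap_expansion
    by (intro conjI exI[of _ wpieces] exI[of _ 1]) auto
qed

lemma periodic_turning_point_wmap: "periodic_turning_point wmap (1/3)"
proof -
  have "\<not> wmap differentiable (at (1/3) within unit_ivl)"
  proof
    assume "wmap differentiable (at (1/3) within unit_ivl)"
    then obtain D where D: "(wmap has_vector_derivative D) (at (1/3) within unit_ivl)"
      using vector_derivative_works by blast
    have "D = 2" if "(wmap has_vector_derivative D) (at (1/3) within {1/3..<2/3})"
    proof -
      have "((\<lambda>x. 2 * x - 1/3) has_vector_derivative D) (at (1/3) within {1/3..<2/3::real})"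
        using that by (rule has_vector_derivative_transform[rotated 2]) (auto simp: wmap_def)
      moreover have "((\<lambda>x. 2 * x - 1/3) has_vector_derivative 2) (at (1/3) within {1/3..<2/3::real})"
        by (auto intro!: derivative_eq_intros
            simp: has_real_derivative_iff_has_vector_derivative[symmetric])
      ultimately show ?thesis
        by (rule vector_derivative_unique_within[rotated])
          (simp add: trivial_limit_within islimpt_Ico)
    qed
    moreover have "D = -2" if "(wmap has_vector_derivative D) (at (1/3) within {0..1/3})"
    proof -
      have "((\<lambda>x. 1 - 2 * x) has_vector_derivative D) (at (1/3) within {0..1/3::real})"
        using that by (rule has_vector_derivative_transform[rotated 2]) (auto simp: wmap_def)
      moreover have "((\<lambda>x. 1 - 2 * x) has_vector_derivative -2) (at (1/3) within {0..1/3::real})"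
        by (auto intro!: derivative_eq_intros
            simp: has_real_derivative_iff_has_vector_derivative[symmetric])
      ultimately show ?thesis
        by (rule vector_derivative_unique_within[rotated])
          (simp add: trivial_limit_within islimpt_Icc)
    qed
    moreover have "{1/3..<2/3} \<subseteq> unit_ivl" "{0..1/3} \<subseteq> unit_ivl" by auto
    ultimately have "D = 2" "D = -2"
      using has_vector_derivative_within_subset[OF D] by blast+
    then show False by simp
  qed
  moreover have "periodic_with wmap 1 (1/3)"
    by (simp add: periodic_with_def wmap_def)
  ultimately show ?thesis
    unfolding periodic_turning_point_def turning_point_def by auto
qed

lemma orbit_wmap: "orbit_of wmap (1/3) = {1/3}"
proof -
  have "(wmap ^^ k) (1/3) = 1/3" for k
    by (induction k) (auto simp: wmap_def)
  then show ?thesis by (auto simp: orbit_of_def)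
qed

lemma repelling_wmap: "repelling_periodic wmap 1 (1/3)"
  unfolding repelling_periodic_def orbit_wmap
proof (intro conjI ballI)
  fix z :: real assume "z \<in> {1/3}"
  then show "\<exists>L>1. \<exists>\<delta>>0. \<forall>x\<in>unit_ivl. \<bar>x - z\<bar> < \<delta> \<longrightarrow> \<bar>(wmap ^^ 1) x - z\<bar> \<ge> L * \<bar>x - z\<bar>"
    \<comment> \<open>With radius 1/3 only the two branches adjoining 1/3 are met, and on both the
      distance to 1/3 is exactly doubled.\<close>
    by (intro exI[of _ 2] exI[of _ "1/3"] conjI) (auto simp: wmap_def abs_if)
qed (simp add: periodic_with_def wmap_def)

lemma wmap_measurable[measurable]: "wmap \<in> leb \<rightarrow>\<^sub>M leb"
proof -
  have "wmap \<in> borel \<rightarrow>\<^sub>M borel"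
    unfolding wmap_def[abs_def] by measurable
  then have "wmap \<in> leb \<rightarrow>\<^sub>M lborel"
    by (simp add: measurable_restrict_space1)
  then show ?thesis
    using wmap_unit by (intro measurable_restrict_space2) (auto simp: space_restrict_space)
qed

section \<open>The point mass at the turning point\<close>

abbreviation turning_delta :: "real measure" where
  "turning_delta \<equiv> return leb (1/3)"

lemma turning_delta_prob: "turning_delta \<in> space (prob_algebra leb)"
  by (auto simp: space_prob_algebra space_restrict_space intro!: prob_space_return)

lemma invariant_turning_delta: "invariant_measure wmap turning_delta"
  unfolding invariant_measure_def using turning_delta_prob
  by (auto simp: distr_return space_restrict_space wmap_def)

lemma singular_turning_delta: "singular_measure turning_delta"
  unfolding singular_measure_def
proof (intro bexI[of _ "{1/3}"] conjI)
  show s: "{1/3} \<in> sets leb" by (auto simp: sets_restrict_space_iff)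
  show "emeasure leb {1/3} = 0" by (simp add: emeasure_restrict_space)
  have "unit_ivl - {1/3} \<in> sets leb" by (auto simp: sets_restrict_space_iff)
  then show "emeasure turning_delta (unit_ivl - {1/3}) = 0" by simp
qed

lemma unstable_turning_delta: "unstable_measure wmap turning_delta"
  unfolding unstable_measure_def
proof (intro conjI exI)
  show "AE x in turning_delta. x \<in> orbit_of wmap (1/3)"
    unfolding orbit_wmap
    by (subst AE_return) (auto simp: space_restrict_space intro!: measurable_restrict_space1)
qed (fact invariant_turning_delta repelling_wmap)+

subsection \<open>Cell averages and variation\<close>

text \<open>For N > 0 the half-open cells of length 1 / (3 * N) tile the whole line, so the jumps at
  0 and 1 of a function extended by 0 are ordinary steps between cells. The end point 1 falls into
  cell 3 * N, outside the index range {0..<3 * N}.\<close>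

definition cell :: "nat \<Rightarrow> int \<Rightarrow> real set" where
  "cell N j = {y. \<lfloor>3 * real N * y\<rfloor> = j}"

definition avg :: "nat \<Rightarrow> (real \<Rightarrow> real) \<Rightarrow> int \<Rightarrow> real" where
  "avg N h j = 3 * real N * (LINT y|lborel. indicator (cell N j) y * h y)"

lemma cell_eq:
  assumes "N > 0"
  shows "cell N j = {of_int j / (3 * real N) ..< (of_int j + 1) / (3 * real N)}"
  using assms by (auto simp: cell_def floor_eq_iff field_simps)

lemma cell_measurable[measurable]: "cell N j \<in> sets borel"
  unfolding cell_def by measurable

lemma cell_shift:
  assumes "N > 0"
  shows "y + of_int i / (3 * real N) \<in> cell N j \<longleftrightarrow> y \<in> cell N (j - i)"
proof -
  have "3 * real N * (y + of_int i / (3 * real N)) = 3 * real N * y + of_int i"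
    using assms by (simp add: field_simps)
  then show ?thesis by (simp add: cell_def) linarith
qed

lemma measure_cell:
  assumes "N > 0"
  shows "measure lborel (cell N j) = 1 / (3 * real N)" "emeasure lborel (cell N j) = 1 / (3 * real N)"
proof -
  have "of_int j / (3 * real N) \<le> (of_int j + 1) / (3 * real N)"
    using assms by (simp add: divide_right_mono)
  moreover have "(of_int j + 1) / (3 * real N) - of_int j / (3 * real N) = 1 / (3 * real N)"
    by (simp add: add_divide_distrib)
  ultimately show "measure lborel (cell N j) = 1 / (3 * real N)"
    "emeasure lborel (cell N j) = 1 / (3 * real N)"
    using assms by (simp_all add: cell_eq)
qed

lemma integrable_cell:
  fixes h :: "real \<Rightarrow> real"
  shows "integrable lborel h \<Longrightarrow> integrable lborel (\<lambda>y. indicator (cell N j) y * h y)"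
  using integrable_mult_indicator[of "cell N j" lborel h] by simp

lemma sum_indicator_cell:
  "finite J \<Longrightarrow> (\<Sum>j\<in>J. indicator (cell N j) y * f j) = (if \<lfloor>3 * real N * y\<rfloor> \<in> J then f \<lfloor>3 * real N * y\<rfloor> else (0::real))"
proof -
  assume "finite J"
  have "(\<Sum>j\<in>J. indicator (cell N j) y * f j) = (\<Sum>j\<in>J. if j = \<lfloor>3 * real N * y\<rfloor> then f j else 0)"
    by (intro sum.cong) (auto simp: cell_def indicator_def)
  then show ?thesis using \<open>finite J\<close> by simp
qed

lemma sum_abs_avg_le:
  assumes h: "integrable lborel h" and J: "finite J" and N: "N > 0"
  shows "(\<Sum>j\<in>J. \<bar>avg N h j\<bar>) \<le> 3 * real N * (LINT y|lborel. \<bar>h y\<bar>)"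
proof -
  have "\<bar>avg N h j\<bar> \<le> 3 * real N * (LINT y|lborel. indicator (cell N j) y * \<bar>h y\<bar>)" for j
    using integral_abs_bound[of lborel "\<lambda>y. indicator (cell N j) y * h y"]
    by (simp add: avg_def abs_mult mult_left_mono)
  then have "(\<Sum>j\<in>J. \<bar>avg N h j\<bar>) \<le> (\<Sum>j\<in>J. 3 * real N * (LINT y|lborel. indicator (cell N j) y * \<bar>h y\<bar>))"
    by (rule sum_mono)
  also have "\<dots> = 3 * real N * (LINT y|lborel. (\<Sum>j\<in>J. indicator (cell N j) y * \<bar>h y\<bar>))"
    using h by (simp add: sum_distrib_left integrable_cell)
  also have "\<dots> \<le> 3 * real N * (LINT y|lborel. \<bar>h y\<bar>)"
  proof (intro mult_left_mono integral_mono)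
    show "(\<Sum>j\<in>J. indicator (cell N j) y * \<bar>h y\<bar>) \<le> \<bar>h y\<bar>" for y
      by (subst sum_indicator_cell[OF J]) simp
  qed (use h in \<open>auto intro!: integrable_cell simp del: sum_mult_indicator sum_indicator_mult\<close>)
  finally show ?thesis .
qed

lemma avg_outside:
  assumes "N > 0" "\<And>y. y \<notin> unit_ivl \<Longrightarrow> h y = 0" "j \<notin> {0..<3 * int N}"
  shows "avg N h j = 0"
proof -
  \<comment> \<open>The point 1 is the only one of the unit interval whose cell has an index outside
    the range.\<close>
  have zero: "indicator (cell N j) y * h y = 0" if "y \<noteq> 1" for y
  proof (rule ccontr)
    assume "indicator (cell N j) y * h y \<noteq> 0"
    then have "\<lfloor>3 * real N * y\<rfloor> = j" "y \<in> unit_ivl"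
      using assms(2)[of y] by (auto simp: cell_def indicator_def split: if_splits)
    with that have y: "\<lfloor>3 * real N * y\<rfloor> = j" "0 \<le> y" "y < 1" by auto
    then have "0 \<le> 3 * real N * y" "3 * real N * y < 3 * real N"
      using assms(1) by auto
    then have "0 \<le> j" "j < 3 * int N"
      unfolding y(1)[symmetric] by (auto simp: floor_less_iff)
    then show False using assms(3) by auto
  qed
  have "AE y in lborel. indicator (cell N j) y * h y = 0"
    using AE_lborel_singleton[of 1] by eventually_elim (rule zero)
  then have "(LINT y|lborel. indicator (cell N j) y * h y) = 0"
    by (rule integral_eq_zero_AE)
  then show ?thesis by (simp add: avg_def)
qed

lemma abs_diff_le_sum_steps:
  fixes c :: "int \<Rightarrow> real"
  assumes "a \<le> b"
  shows "\<bar>c b - c a\<bar> \<le> (\<Sum>j\<in>{a..<b}. \<bar>c (j + 1) - c j\<bar>)"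
  using assms
proof (induction b rule: int_ge_induct)
  case (step i)
  have "{a..<i + 1} = insert i {a..<i}" using step by auto
  then show ?case using step by simp
qed simp

text \<open>Along a monotone sequence the indices are monotone too, so every increment is bounded by
  the steps between two indices, and these blocks of steps are disjoint. Index -1 accounts for the
  jump at the left end.\<close>

lemma pointwise_variation_floor_le:
  fixes c :: "int \<Rightarrow> real"
  assumes K: "K > 0" and c: "\<And>j. j \<notin> {0..<L} \<Longrightarrow> c j = 0"
  shows "pointwise_variation (\<lambda>y. c \<lfloor>K * y\<rfloor>) \<le> ennreal (\<Sum>j\<in>{-1..<L}. \<bar>c (j + 1) - c j\<bar>)"
  unfolding pointwise_variation_def
proof (rule SUP_least, clarify)
  fix n :: nat and t :: "nat \<Rightarrow> real" assume t: "mono t"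
  define s where "s i = \<lfloor>K * t i\<rfloor>" for i
  have s: "s i \<le> s j" if "i \<le> j" for i j
    using monoD[OF t that] K by (auto simp: s_def intro!: floor_mono)
  have "(\<Sum>i<n. \<bar>c (s (Suc i)) - c (s i)\<bar>) \<le> (\<Sum>j\<in>{s 0..<s n}. \<bar>c (j + 1) - c j\<bar>)"
  proof (induction n)
    case (Suc n)
    have "{s 0..<s (Suc n)} = {s 0..<s n} \<union> {s n..<s (Suc n)}"
      using s[of 0 n] s[of n "Suc n"] by auto
    then have "(\<Sum>j\<in>{s 0..<s (Suc n)}. \<bar>c (j + 1) - c j\<bar>)
        = (\<Sum>j\<in>{s 0..<s n}. \<bar>c (j + 1) - c j\<bar>) + (\<Sum>j\<in>{s n..<s (Suc n)}. \<bar>c (j + 1) - c j\<bar>)"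
      by (simp add: sum.union_disjoint ivl_disj_int)
    then show ?case
      using Suc abs_diff_le_sum_steps[OF s[of n "Suc n"], of c] by simp
  qed simp
  also have "\<dots> \<le> (\<Sum>j\<in>{s 0..<s n} \<union> {-1..<L}. \<bar>c (j + 1) - c j\<bar>)"
    by (rule sum_mono2) auto
  also have "\<dots> = (\<Sum>j\<in>{-1..<L}. \<bar>c (j + 1) - c j\<bar>)"
    by (rule sum.mono_neutral_right) (auto simp: c)
  finally show "(\<Sum>i<n. ennreal \<bar>c \<lfloor>K * t (Suc i)\<rfloor> - c \<lfloor>K * t i\<rfloor>\<bar>)
      \<le> ennreal (\<Sum>j\<in>{-1..<L}. \<bar>c (j + 1) - c j\<bar>)"
    by (simp add: s_def sum_ennreal ennreal_leI)
qed

lemma AE_lborel_translate: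
  assumes "AE x in lborel. P (x::real)"
  shows "AE x in lborel. P (x + a)"
proof -
  obtain Z where Z: "Z \<in> null_sets lborel" "{x. \<not> P x} \<subseteq> Z"
    using assms by (auto elim!: AE_E simp: null_sets_def)
  have "{x. x - (-a) \<in> Z} \<in> null_sets lborel"
    by (rule null_sets_translation[OF Z(1)])
  then show ?thesis
    by (rule AE_I') (use Z(2) in auto)
qed

text \<open>All averages become integrals over one common cell, so that differences of averages can
  be taken under a single integral sign.\<close>

lemma avg_translate:
  assumes N: "N > 0"
  shows "avg N h j = 3 * real N * (LINT y|lborel. indicator (cell N 0) y * h (y + of_int j / (3 * real N)))"
proof -
  have "(LINT y|lborel. indicator (cell N j) y * h y)
      = (LINT y|lborel. indicator (cell N j) (of_int j / (3 * real N) + 1 * y) * h (of_int j / (3 * real N) + 1 * y))"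
    using lborel_integral_real_affine[of 1 "\<lambda>y. indicator (cell N j) y * h y" "of_int j / (3 * real N)"] by simp
  also have "\<dots> = (LINT y|lborel. indicator (cell N 0) y * h (y + of_int j / (3 * real N)))"
    using cell_shift[OF N, of _ j j]
    by (intro Bochner_Integration.integral_cong) (auto simp: indicator_def add.commute)
  finally show ?thesis by (simp add: avg_def)
qed

text \<open>The points \<open>y + j / (3 * N)\<close> form a monotone sequence for every fixed \<open>y\<close>; integrating over
  \<open>y \<in> cell N 0\<close> turns the increments along it into increments of averages.\<close>

lemma variation_avg_le:
  fixes h g :: "real \<Rightarrow> real"
  assumes h: "integrable lborel h" and g: "AE x in lborel. g x = h x" and N: "N > 0"
  shows "ennreal (\<Sum>j\<in>{-1..<int L}. \<bar>avg N h (j + 1) - avg N h j\<bar>) \<le> pointwise_variation g"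
proof (cases "pointwise_variation g = \<infinity>")
  case False
  define V where "V = enn2real (pointwise_variation g)"
  have V: "ennreal V = pointwise_variation g"
    using False by (simp add: V_def less_top)
  have V0: "V \<ge> 0" by (simp add: V_def)
  define \<tau> where "\<tau> j = of_int j / (3 * real N)" for j
  have gV: "(\<Sum>j\<in>{-1..<int L}. \<bar>g (y + \<tau> (j + 1)) - g (y + \<tau> j)\<bar>) \<le> V" for y
  proof -
    define t where "t i = y + \<tau> (int i - 1)" for i
    have "mono t" using N by (auto simp: t_def \<tau>_def mono_def divide_right_mono)
    have "(\<Sum>j\<in>{-1..<int L}. \<bar>g (y + \<tau> (j + 1)) - g (y + \<tau> j)\<bar>)
        = (\<Sum>i<Suc L. \<bar>g (t (Suc i)) - g (t i)\<bar>)"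
      by (rule sum.reindex_bij_witness[of _ "\<lambda>i. int i - 1" "\<lambda>j. nat (j + 1)"])
        (auto simp: t_def add.commute)
    moreover have "ennreal (\<Sum>i<Suc L. \<bar>g (t (Suc i)) - g (t i)\<bar>) \<le> pointwise_variation g"
      unfolding pointwise_variation_def
      using \<open>mono t\<close> by (intro SUP_upper2[of "(Suc L, t)"]) (auto simp: sum_ennreal simp del: sum.lessThan_Suc)
    ultimately show ?thesis
      using V0 by (simp add: V[symmetric] del: sum.lessThan_Suc)
  qed
  \<comment> \<open>The representative \<open>g\<close> need not be measurable. The bound is
    therefore obtained pointwise for \<open>g\<close>, passed to \<open>h\<close> almost everywhere,
    and only then integrated.\<close>
  have "AE y in lborel. h (y + \<tau> j) = g (y + \<tau> j)" for j
    using AE_lborel_translate[OF g, of "\<tau> j"] by eventually_elim simp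
  then have "AE y in lborel. \<forall>j\<in>{-1..int L}. h (y + \<tau> j) = g (y + \<tau> j)"
    by (intro AE_finite_allI) auto
  then have hV: "AE y in lborel. (\<Sum>j\<in>{-1..<int L}. \<bar>h (y + \<tau> (j + 1)) - h (y + \<tau> j)\<bar>) \<le> V"
  proof eventually_elim
    case (elim y)
    have "(\<Sum>j\<in>{-1..<int L}. \<bar>h (y + \<tau> (j + 1)) - h (y + \<tau> j)\<bar>)
        = (\<Sum>j\<in>{-1..<int L}. \<bar>g (y + \<tau> (j + 1)) - g (y + \<tau> j)\<bar>)"
      using elim by (intro sum.cong) auto
    then show ?case using gV by simp
  qed
  have hi: "integrable lborel (\<lambda>y. h (y + \<tau> j))" for j
    using lborel_integrable_real_affine[OF h, of 1 "\<tau> j"] by (simp add: add.commute)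
  have "\<bar>avg N h (j + 1) - avg N h j\<bar>
      \<le> 3 * real N * (LINT y|lborel. indicator (cell N 0) y * \<bar>h (y + \<tau> (j + 1)) - h (y + \<tau> j)\<bar>)" for j
  proof -
    have "avg N h (j + 1) - avg N h j
        = 3 * real N * (LINT y|lborel. indicator (cell N 0) y * (h (y + \<tau> (j + 1)) - h (y + \<tau> j)))"
      unfolding avg_translate[OF N] \<tau>_def[symmetric]
      by (simp add: right_diff_distrib integrable_cell hi Bochner_Integration.integral_diff)
    then show ?thesis
      using integral_abs_bound[of lborel "\<lambda>y. indicator (cell N 0) y * (h (y + \<tau> (j + 1)) - h (y + \<tau> j))"]
      by (simp add: abs_mult mult_left_mono)
  qed
  then have "(\<Sum>j\<in>{-1..<int L}. \<bar>avg N h (j + 1) - avg N h j\<bar>)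
      \<le> (\<Sum>j\<in>{-1..<int L}. 3 * real N * (LINT y|lborel. indicator (cell N 0) y * \<bar>h (y + \<tau> (j + 1)) - h (y + \<tau> j)\<bar>))"
    by (rule sum_mono)
  also have "\<dots> = 3 * real N * (LINT y|lborel. indicator (cell N 0) y * (\<Sum>j\<in>{-1..<int L}. \<bar>h (y + \<tau> (j + 1)) - h (y + \<tau> j)\<bar>))"
    by (simp only: sum_distrib_left, subst Bochner_Integration.integral_sum)
      (auto intro!: integrable_cell hi simp: sum_distrib_left)
  also have "\<dots> \<le> 3 * real N * (LINT y|lborel. indicator (cell N 0) y * V)"
  proof (intro mult_left_mono integral_mono_AE)
    show "integrable lborel (\<lambda>y. indicator (cell N 0) y * V)"
      using N by (simp add: measure_cell)
    show "AE y in lborel. indicator (cell N 0) y * (\<Sum>j\<in>{-1..<int L}. \<bar>h (y + \<tau> (j + 1)) - h (y + \<tau> j)\<bar>)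
        \<le> indicator (cell N 0) y * V"
      using hV by eventually_elim (auto simp: indicator_def)
  qed (auto intro!: integrable_cell hi Bochner_Integration.integrable_sum)
  also have "\<dots> = V"
    using N by (simp add: measure_cell)
  finally show ?thesis
    unfolding V[symmetric] by (rule ennreal_leI)
qed simp

subsection \<open>The perturbation\<close>

definition shift_prob :: "nat \<Rightarrow> int \<Rightarrow> real" where
  "shift_prob N j = max 0 (min 1 (of_int j / real N))"

definition kernel_density :: "nat \<Rightarrow> real \<Rightarrow> real \<Rightarrow> real" where
  "kernel_density N x y = (let i = \<lfloor>3 * real N * x\<rfloor> in 3 * real N *
     ((1 - shift_prob N i) * indicator (cell N i) y + shift_prob N i * indicator (cell N (i - 1)) y))"

definition pert :: "nat \<Rightarrow> real \<Rightarrow> real measure" where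
  "pert N x = density leb (\<lambda>y. ennreal (kernel_density N x y))"

text \<open>Balance of mass for cell j: the first term is what stays, the second what arrives from
  the right neighbour.\<close>

definition coef :: "nat \<Rightarrow> (real \<Rightarrow> real) \<Rightarrow> int \<Rightarrow> real" where
  "coef N h j = (1 - shift_prob N j) * avg N h j + shift_prob N (j + 1) * avg N h (j + 1)"

definition step :: "nat \<Rightarrow> (real \<Rightarrow> real) \<Rightarrow> real \<Rightarrow> real" where
  "step N h y = coef N h \<lfloor>3 * real N * y\<rfloor>"

lemma shift_prob_bounds: "0 \<le> shift_prob N j" "shift_prob N j \<le> 1"
  by (auto simp: shift_prob_def)

lemma shift_prob_0: "j \<le> 0 \<Longrightarrow> shift_prob N j = 0"
  using divide_nonpos_nonneg[of "real_of_int j" "real N"] by (simp add: shift_prob_def)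

lemma shift_prob_1: "N > 0 \<Longrightarrow> j \<ge> int N \<Longrightarrow> shift_prob N j = 1"
  by (auto simp: shift_prob_def field_simps)

lemma shift_prob_Suc:
  "shift_prob N j \<le> shift_prob N (j + 1)" "shift_prob N (j + 1) \<le> shift_prob N j + 1 / real N"
proof -
  have "of_int (j + 1) / real N = of_int j / real N + 1 / real N"
    by (simp add: add_divide_distrib)
  moreover have "1 / real N \<ge> 0" by simp
  ultimately show "shift_prob N j \<le> shift_prob N (j + 1)"
    "shift_prob N (j + 1) \<le> shift_prob N j + 1 / real N"
    unfolding shift_prob_def by linarith+
qed

section \<open>Variation of the cell values under the random shift\<close>

lemma sum_shift_int:
  fixes F :: "int \<Rightarrow> real"
  assumes "a \<le> b" "F a = F b"
  shows "(\<Sum>j\<in>{a..<b}. F (j + 1)) = (\<Sum>j\<in>{a..<b}. F j)"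
proof -
  have "(\<Sum>j\<in>{a..<b}. F (j + 1)) = (\<Sum>j\<in>{a + 1..<b + 1}. F j)"
    by (rule sum.reindex_bij_witness[of _ "\<lambda>j. j - 1" "\<lambda>j. j + 1"]) auto
  moreover have "F a + (\<Sum>j\<in>{a + 1..<b + 1}. F j) = (\<Sum>j\<in>{a..<b + 1}. F j)"
  proof -
    have "{a..<b + 1} = insert a {a + 1..<b + 1}" using assms(1) by auto
    then show ?thesis by simp
  qed
  moreover have "(\<Sum>j\<in>{a..<b + 1}. F j) = (\<Sum>j\<in>{a..<b}. F j) + F b"
  proof -
    have "{a..<b + 1} = insert b {a..<b}" using assms(1) by auto
    then show ?thesis by simp
  qed
  ultimately show ?thesis using assms(2) by simp
qed

text \<open>Summation by parts. After a shift of index, the increment of \<open>a\<close> from j to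
  j + 1 carries the weight 1 - p(j) + p(j + 1), where p is \<open>shift_prob N\<close>; this is at
  most 1 + 1 / N. The excess 1 / N costs 2 / N times the sum of the absolute values of
  \<open>a\<close>, and the second difference of p, bounded by 2 / N, costs as much again; hence the
  constant 4.\<close>

lemma sum_diff_coef_le:
  fixes a c :: "int \<Rightarrow> real"
  assumes a: "\<And>j. j \<notin> {0..<int L} \<Longrightarrow> a j = 0"
    and c: "\<And>j. c j = (1 - shift_prob N j) * a j + shift_prob N (j + 1) * a (j + 1)"
  shows "(\<Sum>j\<in>{-1..<int L}. \<bar>c (j + 1) - c j\<bar>)
    \<le> (\<Sum>j\<in>{-1..<int L}. \<bar>a (j + 1) - a j\<bar>) + 4 / real N * (\<Sum>j\<in>{-1..<int L}. \<bar>a j\<bar>)"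
proof -
  let ?p = "shift_prob N"
  define d where "d j = \<bar>a (j + 1) - a j\<bar>" for j
  have "\<bar>c (j + 1) - c j\<bar> \<le> (1 - ?p j) * d j + ?p (j + 2) * d (j + 1) + 2 / real N * \<bar>a (j + 1)\<bar>" for j
  proof -
    have "c (j + 1) - c j = (1 - ?p j) * (a (j + 1) - a j) + ?p (j + 2) * (a (j + 2) - a (j + 1))
        + (?p j - 2 * ?p (j + 1) + ?p (j + 2)) * a (j + 1)"
      by (simp add: c algebra_simps)
    also have "\<bar>\<dots>\<bar> \<le> (1 - ?p j) * d j + ?p (j + 2) * d (j + 1)
        + \<bar>?p j - 2 * ?p (j + 1) + ?p (j + 2)\<bar> * \<bar>a (j + 1)\<bar>"
      using shift_prob_bounds[of N j] shift_prob_bounds[of N "j + 2"]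
      by (intro abs_triangle_ineq[THEN order_trans] add_mono) (auto simp: abs_mult d_def add.commute)
    also have "\<bar>?p j - 2 * ?p (j + 1) + ?p (j + 2)\<bar> \<le> 2 / real N"
    proof -
      have "1 / real N + 1 / real N = 2 / real N" by simp
      then show ?thesis
        using shift_prob_Suc[of N j] shift_prob_Suc[of N "j + 1", unfolded add.assoc one_add_one]
        unfolding abs_le_iff by linarith
    qed
    finally show ?thesis by (simp add: mult_right_mono)
  qed
  then have "(\<Sum>j\<in>{-1..<int L}. \<bar>c (j + 1) - c j\<bar>)
      \<le> (\<Sum>j\<in>{-1..<int L}. (1 - ?p j) * d j + ?p (j + 2) * d (j + 1) + 2 / real N * \<bar>a (j + 1)\<bar>)"
    by (rule sum_mono)
  also have "\<dots> = (\<Sum>j\<in>{-1..<int L}. (1 - ?p j) * d j) + (\<Sum>j\<in>{-1..<int L}. ?p (j + 2) * d (j + 1))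
      + 2 / real N * (\<Sum>j\<in>{-1..<int L}. \<bar>a (j + 1)\<bar>)"
    by (simp only: sum.distrib sum_distrib_left)
  also have "(\<Sum>j\<in>{-1..<int L}. ?p (j + 2) * d (j + 1)) = (\<Sum>j\<in>{-1..<int L}. ?p (j + 1) * d j)"
    using sum_shift_int[of "-1" "int L" "\<lambda>j. ?p (j + 1) * d j"] a
    by (simp add: d_def shift_prob_0 add.commute add.left_commute)
  also have "(\<Sum>j\<in>{-1..<int L}. \<bar>a (j + 1)\<bar>) = (\<Sum>j\<in>{-1..<int L}. \<bar>a j\<bar>)"
    using sum_shift_int[of "-1" "int L" "\<lambda>j. \<bar>a j\<bar>"] a by simp
  also have "(\<Sum>j\<in>{-1..<int L}. (1 - ?p j) * d j) + (\<Sum>j\<in>{-1..<int L}. ?p (j + 1) * d j)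
      = (\<Sum>j\<in>{-1..<int L}. (1 - ?p j + ?p (j + 1)) * d j)"
    by (simp add: distrib_right sum.distrib)
  also have "\<dots> \<le> (\<Sum>j\<in>{-1..<int L}. (1 + 1 / real N) * d j)"
    using shift_prob_Suc[of N] by (intro sum_mono mult_right_mono) (auto simp: d_def algebra_simps)
  also have "\<dots> = (\<Sum>j\<in>{-1..<int L}. d j) + 1 / real N * (\<Sum>j\<in>{-1..<int L}. d j)"
    by (simp only: distrib_right sum.distrib sum_distrib_left mult_1_left)
  also have "1 / real N * (\<Sum>j\<in>{-1..<int L}. d j) \<le> 1 / real N * (2 * (\<Sum>j\<in>{-1..<int L}. \<bar>a j\<bar>))"
  proof (rule mult_left_mono)
    have "(\<Sum>j\<in>{-1..<int L}. d j) \<le> (\<Sum>j\<in>{-1..<int L}. \<bar>a (j + 1)\<bar> + \<bar>a j\<bar>)"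
      by (intro sum_mono) (simp add: d_def)
    also have "\<dots> = 2 * (\<Sum>j\<in>{-1..<int L}. \<bar>a j\<bar>)"
      using sum_shift_int[of "-1" "int L" "\<lambda>j. \<bar>a j\<bar>"] a by (simp add: sum.distrib)
    finally show "(\<Sum>j\<in>{-1..<int L}. d j) \<le> 2 * (\<Sum>j\<in>{-1..<int L}. \<bar>a j\<bar>)" .
  qed simp
  finally show ?thesis by (simp add: d_def algebra_simps)
qed

section \<open>Action on densities: support and contraction in L1\<close>

abbreviation zext :: "(real \<Rightarrow> real) \<Rightarrow> real \<Rightarrow> real" where
  "zext h \<equiv> (\<lambda>x. indicator unit_ivl x * h x)"

lemma integrable_leb: "integrable leb h \<longleftrightarrow> integrable lborel (zext h)"
  by (simp add: integrable_restrict_space)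

lemma integral_leb: "(LINT x|leb. h x) = (LINT x|lborel. zext h x)" for h :: "real \<Rightarrow> real"
  by (simp add: integral_restrict_space)

lemma AE_leb: "(AE x in leb. P x) \<longleftrightarrow> (AE x in lborel. x \<in> unit_ivl \<longrightarrow> P x)"
  by (simp add: AE_restrict_space_iff)

text \<open>Mass could leave the grid only from cell 0 to cell -1, and \<open>shift_prob N 0\<close>
  is 0.\<close>

lemma coef_outside:
  assumes "N > 0" "\<And>y. y \<notin> unit_ivl \<Longrightarrow> h y = 0" "j \<notin> {0..<3 * int N}"
  shows "coef N h j = 0"
proof (cases "j = -1")
  case True
  then show ?thesis using avg_outside[OF assms] by (simp add: coef_def shift_prob_0)
next
  case False
  then have "j + 1 \<notin> {0..<3 * int N}" using assms(3) by auto
  then show ?thesis using avg_outside[of N h, OF assms(1,2)] assms(3) by (simp add: coef_def)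
qed

lemma step_eq_sum:
  assumes "N > 0" "\<And>y. y \<notin> unit_ivl \<Longrightarrow> h y = 0"
  shows "step N h y = (\<Sum>j\<in>{0..<3 * int N}. indicator (cell N j) y * coef N h j)"
  using coef_outside[OF assms] by (subst sum_indicator_cell) (auto simp: step_def)

lemma step_outside:
  assumes "N > 0" "\<And>y. y \<notin> unit_ivl \<Longrightarrow> h y = 0" "y \<notin> unit_ivl"
  shows "step N h y = 0"
proof -
  have "3 * real N * y < 0 \<or> 3 * real N \<le> 3 * real N * y"
    using assms(1,3) by (auto simp: mult_less_0_iff)
  then have "\<lfloor>3 * real N * y\<rfloor> \<notin> {0..<3 * int N}"
    by (auto simp: floor_less_iff)
  then show ?thesis using coef_outside[OF assms(1,2)] by (simp add: step_def)
qed

lemma integrable_step: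
  assumes "N > 0" "\<And>y. y \<notin> unit_ivl \<Longrightarrow> h y = 0"
  shows "integrable lborel (step N h)"
proof -
  have "step N h = (\<lambda>y. \<Sum>j\<in>{0..<3 * int N}. indicator (cell N j) y * coef N h j)"
    by (rule HOL.ext) (rule step_eq_sum[OF assms])
  then show ?thesis
    using assms(1) by (simp only:, intro Bochner_Integration.integrable_sum) (auto simp: measure_cell)
qed

lemma abs_coef_le:
  "\<bar>coef N h j\<bar> \<le> (1 - shift_prob N j) * \<bar>avg N h j\<bar> + shift_prob N (j + 1) * \<bar>avg N h (j + 1)\<bar>"
  using shift_prob_bounds[of N] unfolding coef_def
  by (intro abs_triangle_ineq[THEN order_trans]) (auto simp: abs_mult)

text \<open>Each average is split with weights 1 - p and p, which a shift of index collects back to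
  1; averaging itself does not increase the L1 norm.\<close>

lemma integral_abs_step_le:
  assumes N: "N > 0" and h: "integrable lborel h" "\<And>y. y \<notin> unit_ivl \<Longrightarrow> h y = 0"
  shows "(LINT y|lborel. \<bar>step N h y\<bar>) \<le> (LINT y|lborel. \<bar>h y\<bar>)"
proof -
  let ?J = "{0..<3 * int N}"
  let ?p = "shift_prob N" and ?a = "\<lambda>j. \<bar>avg N h j\<bar>"
  have "(LINT y|lborel. \<bar>step N h y\<bar>) = (LINT y|lborel. (\<Sum>j\<in>?J. indicator (cell N j) y * \<bar>coef N h j\<bar>))"
    using coef_outside[OF N h(2)] by (subst sum_indicator_cell) (auto simp: step_def intro!: Bochner_Integration.integral_cong)
  also have "\<dots> = (\<Sum>j\<in>?J. 1 / (3 * real N) * \<bar>coef N h j\<bar>)"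
    using N by (subst Bochner_Integration.integral_sum) (auto simp: measure_cell)
  also have "\<dots> \<le> (\<Sum>j\<in>?J. 1 / (3 * real N) * ((1 - ?p j) * ?a j + ?p (j + 1) * ?a (j + 1)))"
    by (intro sum_mono mult_left_mono abs_coef_le) auto
  also have "\<dots> = 1 / (3 * real N) * ((\<Sum>j\<in>?J. (1 - ?p j) * ?a j) + (\<Sum>j\<in>?J. ?p (j + 1) * ?a (j + 1)))"
    by (simp only: sum_distrib_left sum.distrib distrib_left)
  also have "(\<Sum>j\<in>?J. ?p (j + 1) * ?a (j + 1)) = (\<Sum>j\<in>?J. ?p j * ?a j)"
    using sum_shift_int[of 0 "3 * int N" "\<lambda>j. ?p j * ?a j"] avg_outside[OF N h(2)]
    by (simp add: shift_prob_0)
  also have "(\<Sum>j\<in>?J. (1 - ?p j) * ?a j) + (\<Sum>j\<in>?J. ?p j * ?a j) = (\<Sum>j\<in>?J. ?a j)"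
    by (simp add: sum.distrib[symmetric] algebra_simps)
  also have "1 / (3 * real N) * (\<Sum>j\<in>?J. ?a j) \<le> 1 / (3 * real N) * (3 * real N * (LINT y|lborel. \<bar>h y\<bar>))"
    using sum_abs_avg_le[OF h(1) _ N, of ?J] by (intro mult_left_mono) auto
  finally show ?thesis using N by simp
qed

section \<open>The kernel as a smooth, local transition probability\<close>

lemma kernel_density_nonneg: "0 \<le> kernel_density N x y"
  using shift_prob_bounds[of N] by (auto simp: kernel_density_def Let_def)

lemma kernel_density_measurable[measurable]:
  "case_prod (kernel_density N) \<in> borel_measurable (borel \<Otimes>\<^sub>M borel)"
  unfolding kernel_density_def shift_prob_def Let_def split_beta indicator_def cell_def mem_Collect_eq
  by measurable

lemma kernel_density_measurable_leb[measurable]: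
  "case_prod (kernel_density N) \<in> borel_measurable (leb \<Otimes>\<^sub>M leb)"
proof -
  have id: "(\<lambda>x. x) \<in> leb \<rightarrow>\<^sub>M borel"
    by (simp add: measurable_restrict_space1)
  have "(\<lambda>z. (fst z, snd z)) \<in> leb \<Otimes>\<^sub>M leb \<rightarrow>\<^sub>M borel \<Otimes>\<^sub>M borel"
    by (intro measurable_Pair measurable_compose[OF measurable_fst id]
        measurable_compose[OF measurable_snd id])
  from measurable_compose[OF this kernel_density_measurable] show ?thesis by simp
qed

lemma kernel_density_measurable2[measurable]: "kernel_density N x \<in> borel_measurable borel"
  unfolding kernel_density_def Let_def by measurable

lemma kernel_density_measurable2_leb[measurable]: "kernel_density N x \<in> borel_measurable leb"
  by (rule measurable_restrict_space1) measurable

lemma measure_pert: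
  assumes A: "A \<in> sets leb" and N: "N > 0"
  defines "m \<equiv> \<lambda>j. measure lborel (A \<inter> cell N j)"
  defines "w \<equiv> \<lambda>i. 3 * real N * ((1 - shift_prob N i) * m i + shift_prob N i * m (i - 1))"
  shows "measure (pert N x) A = w \<lfloor>3 * real N * x\<rfloor>"
proof -
  define i where "i = \<lfloor>3 * real N * x\<rfloor>"
  have A': "A \<subseteq> unit_ivl" "A \<in> sets borel"
    using A by (auto simp: sets_restrict_space_iff)
  have [simp]: "emeasure lborel (A \<inter> cell N j) < \<top>" for j
  proof -
    have "emeasure lborel (A \<inter> cell N j) \<le> emeasure lborel (cell N j)"
      by (intro emeasure_mono) auto
    also have "\<dots> < \<top>" using N by (simp add: measure_cell)
    finally show ?thesis .
  qed
  have [simp]: "integrable lborel (\<lambda>y. indicator A y * indicator (cell N j) y :: real)" for j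
    using A' by (subst indicator_inter_arith[symmetric]) (auto intro!: integrable_real_indicator)
  have [simp]: "(LINT y|lborel. indicator A y * indicator (cell N j) y :: real) = m j" for j
    using A' by (simp add: indicator_inter_arith[symmetric] m_def)
  have "measure (pert N x) A = (LINT y|pert N x. indicator A y)"
    using A A'(1) by (simp add: pert_def Int_absorb2 space_restrict_space)
  also have "\<dots> = (LINT y|leb. kernel_density N x y * indicator A y)"
    unfolding pert_def using A by (subst integral_density) (auto simp: kernel_density_nonneg)
  also have "\<dots> = (LINT y|lborel. indicator A y * kernel_density N x y)"
    unfolding integral_leb using A'
    by (intro Bochner_Integration.integral_cong) (auto simp: indicator_def)
  also have "\<dots> = (LINT y|lborel. 3 * real N * ((1 - shift_prob N i) * (indicator A y * indicator (cell N i) y)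
       + shift_prob N i * (indicator A y * indicator (cell N (i - 1)) y)))"
    by (intro Bochner_Integration.integral_cong) (auto simp: kernel_density_def Let_def i_def algebra_simps)
  also have "\<dots> = w i"
    unfolding w_def by (subst integral_mult_right_zero, subst Bochner_Integration.integral_add) auto
  finally show ?thesis by (simp add: i_def)
qed

lemma sets_pert[simp]: "sets (pert N x) = sets leb" "space (pert N x) = unit_ivl"
  by (auto simp: pert_def space_restrict_space)

lemma floor_unit:
  assumes "x \<in> unit_ivl"
  shows "0 \<le> \<lfloor>3 * real N * x\<rfloor>" "\<lfloor>3 * real N * x\<rfloor> \<le> 3 * int N"
proof -
  have "3 * real N * x \<le> 3 * real N * 1" using assms by (intro mult_left_mono) auto
  then show "\<lfloor>3 * real N * x\<rfloor> \<le> 3 * int N" by (simp add: floor_le_iff)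
qed (use assms in auto)

lemma cell_subset_unit:
  assumes "N > 0" "0 \<le> j" "j < 3 * int N"
  shows "cell N j \<subseteq> unit_ivl"
proof -
  have "of_int j + 1 \<le> 3 * real N" using assms(3) by linarith
  then have "(of_int j + 1) / (3 * real N) \<le> 1" using assms(1) by simp
  moreover have "0 \<le> of_int j / (3 * real N)" using assms(2) by simp
  ultimately show ?thesis unfolding cell_eq[OF assms(1)] by auto
qed

lemma prob_space_pert:
  assumes N: "N > 0" and x: "x \<in> unit_ivl"
  shows "prob_space (pert N x)"
proof -
  define i where "i = \<lfloor>3 * real N * x\<rfloor>"
  have m: "measure lborel (unit_ivl \<inter> cell N j) = 1 / (3 * real N)" if "0 \<le> j" "j < 3 * int N" for j
    using cell_subset_unit[OF N that] measure_cell[OF N] by (simp add: Int_absorb1)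
  have i: "0 \<le> i" "i \<le> 3 * int N" using floor_unit[OF x] by (auto simp: i_def)
  have "measure (pert N x) unit_ivl
      = 3 * real N * ((1 - shift_prob N i) * measure lborel (unit_ivl \<inter> cell N i)
        + shift_prob N i * measure lborel (unit_ivl \<inter> cell N (i - 1)))"
    unfolding i_def by (rule measure_pert) (auto simp: N sets_restrict_space_iff)
  also have "\<dots> = 1"
  proof -
    \<comment> \<open>For index 0 there is no shift, so nothing goes to cell -1. Index 3 * N occurs
      only for x = 1, where the shift is certain and leads into the last cell. In between, both
      cells lie in the unit interval.\<close>
    consider "i = 0" | "0 < i" "i < 3 * int N" | "i = 3 * int N" using i by linarith
    then show ?thesis
      by cases (use N in \<open>auto simp: m shift_prob_0 shift_prob_1 field_simps\<close>)
  qed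
  finally have "enn2real (emeasure (pert N x) unit_ivl) = 1"
    by (simp add: measure_def)
  then have "emeasure (pert N x) unit_ivl = 1"
    by (cases "emeasure (pert N x) unit_ivl") auto
  then show ?thesis by (intro prob_spaceI) simp
qed

lemma transition_prob_pert:
  assumes "N > 0"
  shows "transition_prob (pert N)"
  unfolding transition_prob_def
proof (rule measurable_prob_algebraI)
  show "pert N \<in> leb \<rightarrow>\<^sub>M subprob_algebra leb"
  proof (rule measurable_subprob_algebra)
    fix A assume A[measurable]: "A \<in> sets leb"
    have "(\<lambda>x. \<integral>\<^sup>+y. ennreal (kernel_density N x y) * indicator A y \<partial>leb) \<in> borel_measurable leb"
      using sigma_finite_lborel
      by (intro sigma_finite_measure.borel_measurable_nn_integral sigma_finite_measure_restrict_space) measurable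
    then show "(\<lambda>x. emeasure (pert N x) A) \<in> borel_measurable leb"
      unfolding pert_def by (simp add: emeasure_density)
  qed (use assms prob_space_pert in \<open>auto simp: space_restrict_space intro: prob_space_imp_subprob_space\<close>)
qed (use assms prob_space_pert in \<open>auto simp: space_restrict_space\<close>)

lemma smooth_kernel_pert: "smooth_kernel (pert N)"
  unfolding smooth_kernel_def
proof (intro exI conjI ballI)
  show "case_prod (\<lambda>x y. ennreal (kernel_density N x y)) \<in> borel_measurable (leb \<Otimes>\<^sub>M leb)"
    by measurable
  show "emeasure (pert N x) A = (\<integral>\<^sup>+y\<in>A. ennreal (kernel_density N x y) \<partial>leb)" if "A \<in> sets leb" for x A
    unfolding pert_def using that by (subst emeasure_density) auto
qed

text \<open>The mass sits on the cell of \<open>x\<close> and its left neighbour, hence within two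
  cell lengths of \<open>x\<close>.\<close>

lemma emeasure_pert_distant:
  assumes N: "N > 0" "2 / (3 * real N) \<le> \<epsilon>" and A: "A \<in> sets leb" and d: "infdist x A > \<epsilon>"
  shows "emeasure (pert N x) A = 0"
proof -
  have "kernel_density N x y = 0" if "y \<in> A" for y
  proof (rule ccontr)
    assume "kernel_density N x y \<noteq> 0"
    then have "\<lfloor>3 * real N * y\<rfloor> = \<lfloor>3 * real N * x\<rfloor> \<or> \<lfloor>3 * real N * y\<rfloor> = \<lfloor>3 * real N * x\<rfloor> - 1"
      by (auto simp: kernel_density_def Let_def cell_def indicator_def split: if_splits)
    then have "\<bar>3 * real N * x - 3 * real N * y\<bar> \<le> 2" by linarith
    then have "3 * real N * dist x y \<le> 2"
      by (simp add: dist_real_def abs_mult right_diff_distrib[symmetric])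
    then have "dist x y \<le> 2 / (3 * real N)" using N(1) by (simp add: field_simps)
    with infdist_le[OF that, of x] d N(2) show False by linarith
  qed
  then have "(\<integral>\<^sup>+y. ennreal (kernel_density N x y) * indicator A y \<partial>leb) = (\<integral>\<^sup>+y. 0 \<partial>leb)"
    by (intro nn_integral_cong) (auto simp: indicator_def)
  then show ?thesis unfolding pert_def using A by (simp add: emeasure_density)
qed

text \<open>Both sides are expanded over cells. A shift of the summation index turns the mass sent
  out by each cell, on the right-hand side, into the mass received by each cell, on the left-hand
  side.\<close>

lemma step_represents:
  assumes N: "N > 0" and h: "integrable leb h" and A: "A \<in> sets leb"
  shows "(LINT y:A|leb. step N (zext h) y) = (LINT x|leb. h x * measure (pert N x) A)"
proof -
  \<comment> \<open>One index more than the cells of the unit interval, since the point 1 has index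
    3 * N.\<close>
  let ?J = "{0..<3 * int N + 1}" and ?p = "shift_prob N" and ?a = "avg N (zext h)"
  define m where "m = (\<lambda>j. measure lborel (A \<inter> cell N j))"
  define w where "w = (\<lambda>i. 3 * real N * ((1 - ?p i) * m i + ?p i * m (i - 1)))"
  have A': "A \<subseteq> unit_ivl" "A \<in> sets borel"
    using A by (auto simp: sets_restrict_space_iff)
  have out: "?a j = 0" if "j \<notin> {0..<3 * int N}" for j
    by (rule avg_outside[OF N _ that]) auto
  have fin: "emeasure lborel (A \<inter> cell N j) < \<top>" for j
  proof -
    have "emeasure lborel (A \<inter> cell N j) \<le> emeasure lborel (cell N j)"
      by (intro emeasure_mono) auto
    also have "\<dots> < \<top>" using N by (simp add: measure_cell)
    finally show ?thesis .
  qed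
  have int_A: "integrable lborel (\<lambda>y. indicator (cell N j) y * indicator A y :: real)"
    "(LINT y|lborel. indicator (cell N j) y * indicator A y :: real) = m j" for j
    using A' fin[of j] by (simp_all add: indicator_inter_arith[symmetric] m_def Int_commute)
  have "(LINT y:A|leb. step N (zext h) y)
      = (LINT y|lborel. (\<Sum>j\<in>?J. indicator (cell N j) y * (coef N (zext h) j * indicator A y)))"
    unfolding set_lebesgue_integral_def integral_leb
  proof (intro Bochner_Integration.integral_cong refl)
    fix y
    show "indicator unit_ivl y * (indicator A y *\<^sub>R step N (zext h) y)
        = (\<Sum>j\<in>?J. indicator (cell N j) y * (coef N (zext h) j * indicator A y))"
      using A' floor_unit[of y N] by (subst sum_indicator_cell) (auto simp: step_def indicator_def)
  qed
  also have "\<dots> = (LINT y|lborel. (\<Sum>j\<in>?J. coef N (zext h) j * (indicator (cell N j) y * indicator A y)))"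
    by (intro Bochner_Integration.integral_cong sum.cong) auto
  also have "\<dots> = (\<Sum>j\<in>?J. (LINT y|lborel. coef N (zext h) j * (indicator (cell N j) y * indicator A y)))"
    by (intro Bochner_Integration.integral_sum integrable_mult_right int_A(1))
  also have "\<dots> = (\<Sum>j\<in>?J. coef N (zext h) j * m j)"
    by (simp only: integral_mult_right_zero int_A(2))
  finally have L: "(LINT y:A|leb. step N (zext h) y) = (\<Sum>j\<in>?J. coef N (zext h) j * m j)" .
  have "(LINT x|leb. h x * measure (pert N x) A)
      = (LINT x|lborel. (\<Sum>j\<in>?J. indicator (cell N j) x * (w j * zext h x)))"
    unfolding integral_leb
  proof (intro Bochner_Integration.integral_cong refl)
    fix x
    show "indicator unit_ivl x * (h x * measure (pert N x) A)
        = (\<Sum>j\<in>?J. indicator (cell N j) x * (w j * zext h x))"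
      using floor_unit[of x N] measure_pert[OF A N, of x]
      by (subst sum_indicator_cell) (auto simp: indicator_def w_def m_def)
  qed
  also have "\<dots> = (LINT x|lborel. (\<Sum>j\<in>?J. w j * (indicator (cell N j) x * zext h x)))"
    by (simp only: mult.left_commute)
  also have "\<dots> = (\<Sum>j\<in>?J. (LINT x|lborel. w j * (indicator (cell N j) x * zext h x)))"
    using h unfolding integrable_leb
    by (intro Bochner_Integration.integral_sum integrable_mult_right integrable_cell)
  also have "\<dots> = (\<Sum>j\<in>?J. (1 - ?p j) * ?a j * m j + ?p j * ?a j * m (j - 1))"
    by (simp only: integral_mult_right_zero) (auto simp: w_def avg_def algebra_simps intro!: sum.cong)
  also have "\<dots> = (\<Sum>j\<in>?J. (1 - ?p j) * ?a j * m j) + (\<Sum>j\<in>?J. ?p j * ?a j * m (j - 1))"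
    by (rule sum.distrib)
  also have "(\<Sum>j\<in>?J. ?p j * ?a j * m (j - 1)) = (\<Sum>j\<in>?J. ?p (j + 1) * ?a (j + 1) * m j)"
    using sum_shift_int[of 0 "3 * int N + 1" "\<lambda>j. ?p j * ?a j * m (j - 1)"] out
    by (simp add: shift_prob_0)
  also have "(\<Sum>j\<in>?J. (1 - ?p j) * ?a j * m j) + \<dots> = (\<Sum>j\<in>?J. coef N (zext h) j * m j)"
    by (simp add: sum.distrib[symmetric] coef_def algebra_simps)
  finally show ?thesis using L by simp
qed

text \<open>\<open>kernel_op\<close> is an arbitrary choice among integrable functions with
  prescribed integrals over all Borel sets. \<open>step\<close> is one of these functions, and any
  two of them agree almost everywhere.\<close>

lemma kernel_op_pert:
  assumes N: "N > 0" and h: "integrable leb h"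
  shows "integrable leb (kernel_op (pert N) h)"
    and "AE y in leb. kernel_op (pert N) h y = step N (zext h) y"
proof -
  define P where "P k \<longleftrightarrow> integrable leb k \<and>
    (\<forall>A\<in>sets leb. (LINT y:A|leb. k y) = (LINT x|leb. h x * measure (pert N x) A))" for k
  have out: "step N (zext h) y = 0" if "y \<notin> unit_ivl" for y
    by (rule step_outside[OF N _ that]) auto
  have "zext (step N (zext h)) = step N (zext h)"
  proof
    show "zext (step N (zext h)) y = step N (zext h) y" for y
      using out[of y] by (cases "y \<in> unit_ivl") auto
  qed
  moreover have "integrable lborel (step N (zext h))"
    by (rule integrable_step[OF N]) auto
  ultimately have s: "P (step N (zext h))"
    using step_represents[OF N h] by (simp add: P_def integrable_leb)
  then have k: "P (kernel_op (pert N) h)"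
    unfolding kernel_op_def P_def[symmetric] by (rule someI[of P])
  then show "integrable leb (kernel_op (pert N) h)" by (simp add: P_def)
  from k s show "AE y in leb. kernel_op (pert N) h y = step N (zext h) y"
    by (intro density_unique_real) (auto simp: P_def)
qed

lemma norm1_kernel_op_diff:
  assumes N: "N > 0" and h: "integrable leb h"
  shows "norm1 (\<lambda>y. kernel_op (pert N) h y - h y) = (LINT y|lborel. \<bar>step N (zext h) y - zext h y\<bar>)"
proof -
  have out: "step N (zext h) y = 0" if "y \<notin> unit_ivl" for y
    by (rule step_outside[OF N _ that]) auto
  have [measurable]: "h \<in> borel_measurable leb" using h by auto
  have s: "integrable lborel (step N (zext h))"
    by (rule integrable_step[OF N]) auto
  then have [measurable]: "step N (zext h) \<in> borel_measurable leb"
    by (intro measurable_restrict_space1) auto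
  have k: "integrable leb (kernel_op (pert N) h)" 
    by (rule kernel_op_pert(1)[OF N h])
  have "norm1 (\<lambda>y. kernel_op (pert N) h y - h y) = (LINT y|leb. \<bar>step N (zext h) y - h y\<bar>)"
    unfolding norm1_def using kernel_op_pert(2)[OF N h] k
    by (intro integral_cong_AE) (auto elim: eventually_mono)
  also have "\<dots> = (LINT y|lborel. \<bar>step N (zext h) y - zext h y\<bar>)"
    unfolding integral_leb using out
    by (intro Bochner_Integration.integral_cong) (auto simp: indicator_def)
  finally show ?thesis .
qed

lemma var_cong_AE:
  assumes "AE y in leb. h y = k y"
  shows "var h = var k"
proof -
  have "AE x in lborel. (if x \<in> unit_ivl then h x else 0) = (if x \<in> unit_ivl then k x else 0)"
    using assms unfolding AE_leb by eventually_elim auto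
  then have "(AE x in lborel. g x = (if x \<in> unit_ivl then h x else 0))
      \<longleftrightarrow> (AE x in lborel. g x = (if x \<in> unit_ivl then k x else 0))" for g
    by (auto elim: eventually_elim2)
  then show ?thesis unfolding var_def by simp
qed

text \<open>Averaging does not increase the variation; the shift adds 4 / N times the sum of the
  absolute cell averages, which is at most 3 * N times the L1 norm. This gives the constant 12,
  independent of N.\<close>

lemma var_kernel_op_le:
  assumes N: "N > 0" and h: "integrable leb h"
  shows "var (kernel_op (pert N) h) \<le> var h + ennreal (12 * norm1 h)"
proof -
  let ?a = "avg N (zext h)" and ?J = "{-1..<int (3 * N)}"
  have zh: "integrable lborel (zext h)" using h by (simp add: integrable_leb)
  have out: "step N (zext h) y = 0" if "y \<notin> unit_ivl" for y
    by (rule step_outside[OF N _ that]) auto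
  have outa: "?a j = 0" if "j \<notin> {0..<int (3 * N)}" for j
    by (rule avg_outside[OF N]) (use that in auto)
  have outc: "coef N (zext h) j = 0" if "j \<notin> {0..<int (3 * N)}" for j
    by (rule coef_outside[OF N]) (use that in auto)
  have "var (kernel_op (pert N) h) = var (step N (zext h))"
    by (rule var_cong_AE[OF kernel_op_pert(2)[OF N h]])
  also have "\<dots> \<le> pointwise_variation (step N (zext h))"
    unfolding var_def using out by (intro INF_lower) auto
  also have "\<dots> \<le> ennreal (\<Sum>j\<in>?J. \<bar>coef N (zext h) (j + 1) - coef N (zext h) j\<bar>)"
    unfolding step_def[abs_def] by (rule pointwise_variation_floor_le) (use N outc in auto)
  also have "\<dots> \<le> ennreal ((\<Sum>j\<in>?J. \<bar>?a (j + 1) - ?a j\<bar>) + 4 / real N * (\<Sum>j\<in>?J. \<bar>?a j\<bar>))"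
    by (intro ennreal_leI sum_diff_coef_le outa) (auto simp: coef_def)
  also have "\<dots> \<le> ennreal ((\<Sum>j\<in>?J. \<bar>?a (j + 1) - ?a j\<bar>) + 12 * norm1 h)"
  proof (intro ennreal_leI add_left_mono)
    have "4 / real N * (\<Sum>j\<in>?J. \<bar>?a j\<bar>) \<le> 4 / real N * (3 * real N * (LINT y|lborel. \<bar>zext h y\<bar>))"
      by (intro mult_left_mono sum_abs_avg_le zh N) auto
    also have "\<dots> = 12 * norm1 h"
      using N by (simp add: norm1_def integral_leb abs_mult)
    finally show "4 / real N * (\<Sum>j\<in>?J. \<bar>?a j\<bar>) \<le> 12 * norm1 h" .
  qed
  also have "\<dots> = ennreal (\<Sum>j\<in>?J. \<bar>?a (j + 1) - ?a j\<bar>) + ennreal (12 * norm1 h)"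
    by (rule ennreal_plus) (auto simp: norm1_def intro!: sum_nonneg)
  also have "ennreal (\<Sum>j\<in>?J. \<bar>?a (j + 1) - ?a j\<bar>) \<le> var h"
    unfolding var_def
  proof (rule INF_greatest, clarify)
    fix g assume "AE x in lborel. g x = (if x \<in> unit_ivl then h x else 0)"
    then have "AE x in lborel. g x = zext h x" by eventually_elim auto
    then show "ennreal (\<Sum>j\<in>?J. \<bar>?a (j + 1) - ?a j\<bar>) \<le> pointwise_variation g"
      by (rule variation_avg_le[OF zh _ N])
  qed
  finally show ?thesis by (simp add: add_right_mono)
qed

subsection \<open>Convergence of the perturbation to the identity\<close>

definition step_error :: "nat \<Rightarrow> (real \<Rightarrow> real) \<Rightarrow> real" where
  "step_error N h = (LINT y|lborel. \<bar>step N h y - h y\<bar>)"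

lemma step_add:
  assumes "integrable lborel f" "integrable lborel g"
  shows "step N (\<lambda>x. f x + g x) y = step N f y + step N g y"
proof -
  have "avg N (\<lambda>x. f x + g x) j = avg N f j + avg N g j" for j
    using assms by (simp add: avg_def distrib_left integrable_cell)
  then show ?thesis by (simp add: step_def coef_def algebra_simps)
qed

lemma step_cmult: "step N (\<lambda>x. c * f x) y = c * step N f y"
proof -
  have "(LINT x|lborel. indicator (cell N j) x * (c * f x)) = c * (LINT x|lborel. indicator (cell N j) x * f x)" for j
    by (subst integral_mult_right_zero[symmetric]) (simp only: mult.left_commute)
  then have "avg N (\<lambda>x. c * f x) j = c * avg N f j" for j
    by (simp add: avg_def)
  then show ?thesis by (simp add: step_def coef_def algebra_simps)
qed

lemma step_error_cmult: "step_error N (\<lambda>x. c * f x) = \<bar>c\<bar> * step_error N f"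
  by (simp add: step_error_def step_cmult right_diff_distrib[symmetric] abs_mult)

context
  fixes N :: nat assumes N: "N > 0"
begin

lemma integrable_step_error:
  assumes "integrable lborel f" "\<And>y. y \<notin> unit_ivl \<Longrightarrow> f y = 0"
  shows "integrable lborel (\<lambda>y. \<bar>step N f y - f y\<bar>)"
  using integrable_step[OF N] assms by auto

lemma step_error_add:
  assumes f: "integrable lborel f" "\<And>y. y \<notin> unit_ivl \<Longrightarrow> f y = 0"
    and g: "integrable lborel g" "\<And>y. y \<notin> unit_ivl \<Longrightarrow> g y = 0"
  shows "step_error N (\<lambda>x. f x + g x) \<le> step_error N f + step_error N g"
proof -
  have "step_error N (\<lambda>x. f x + g x) \<le> (LINT y|lborel. \<bar>step N f y - f y\<bar> + \<bar>step N g y - g y\<bar>)"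
    unfolding step_error_def
    by (intro integral_mono integrable_step_error Bochner_Integration.integrable_add f(1) g(1))
      (auto simp: f g step_add)
  then show ?thesis
    using integrable_step_error[OF f] integrable_step_error[OF g] by (simp add: step_error_def)
qed

text \<open>The bound is uniform in N, which is what closes the class of well approximated functions
  under limits in L1. The factor 2 counts the contraction \<open>step\<close> and the
  identity.\<close>

lemma step_error_le:
  assumes f: "integrable lborel f" "\<And>y. y \<notin> unit_ivl \<Longrightarrow> f y = 0"
  shows "step_error N f \<le> 2 * (LINT y|lborel. \<bar>f y\<bar>)"
proof -
  have s: "integrable lborel (step N f)" using integrable_step[OF N f(2)] .
  have "step_error N f \<le> (LINT y|lborel. \<bar>step N f y\<bar> + \<bar>f y\<bar>)"
    unfolding step_error_def using s f(1) by (intro integral_mono) auto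
  also have "\<dots> = (LINT y|lborel. \<bar>step N f y\<bar>) + (LINT y|lborel. \<bar>f y\<bar>)"
    using s f(1) by simp
  finally show ?thesis using integral_abs_step_le[OF N f] by simp
qed

end

lemma step_error_nonneg: "0 \<le> step_error N f"
  by (simp add: step_error_def)

text \<open>Among integrable functions vanishing outside the unit interval, those with this property
  are closed under linear combinations and L1 limits. It is therefore enough to treat intervals;
  Borel sets and integrable functions follow by induction.\<close>

definition well_approximated :: "(real \<Rightarrow> real) \<Rightarrow> bool" where
  "well_approximated h \<longleftrightarrow> (\<lambda>N. step_error N h) \<longlonglongrightarrow> 0"

lemma well_approximated_squeeze:
  assumes "\<And>N. N > 0 \<Longrightarrow> step_error N h \<le> e N" "e \<longlonglongrightarrow> 0"
  shows "well_approximated h"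
  unfolding well_approximated_def
  by (rule tendsto_sandwich[OF _ _ tendsto_const assms(2)])
    (auto intro: eventually_mono[OF eventually_gt_at_top[of 0]] assms(1) simp: step_error_nonneg)

lemma well_approximated_add:
  assumes f: "integrable lborel f" "\<And>y. y \<notin> unit_ivl \<Longrightarrow> f y = 0" "well_approximated f"
    and g: "integrable lborel g" "\<And>y. y \<notin> unit_ivl \<Longrightarrow> g y = 0" "well_approximated g"
  shows "well_approximated (\<lambda>x. f x + g x)"
proof (rule well_approximated_squeeze)
  show "(\<lambda>N. step_error N f + step_error N g) \<longlonglongrightarrow> 0"
    using tendsto_add[of _ 0 _ _ 0] f(3) g(3) by (simp add: well_approximated_def)
qed (rule step_error_add[OF _ f(1,2) g(1,2)])

lemma well_approximated_cmult:
  "well_approximated f \<Longrightarrow> well_approximated (\<lambda>x. c * f x)"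
  unfolding well_approximated_def step_error_cmult by (rule tendsto_mult_right_zero)

lemma well_approximated_lim:
  assumes h: "integrable lborel h" "\<And>y. y \<notin> unit_ivl \<Longrightarrow> h y = 0"
    and s: "\<And>n. integrable lborel (s n)" "\<And>n y. y \<notin> unit_ivl \<Longrightarrow> s n y = 0"
    and w: "\<And>n. well_approximated (s n)"
    and lim: "(\<lambda>n. LINT y|lborel. \<bar>h y - s n y\<bar>) \<longlonglongrightarrow> 0"
  shows "well_approximated h"
  unfolding well_approximated_def
proof (rule LIMSEQ_I)
  fix r :: real assume "r > 0"
  \<comment> \<open>The value \<open>r / 4\<close> is chosen because \<open>step_error_le\<close>
    doubles this distance, and the other half of \<open>r\<close> is reserved for the error of
    \<open>s n\<close>.\<close>
  then obtain n where n: "(LINT y|lborel. \<bar>h y - s n y\<bar>) < r / 4"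
    using LIMSEQ_D[OF lim, of "r / 4"] by fastforce
  obtain N0 where N0: "step_error N (s n) < r / 2" if "N \<ge> N0" for N
    using LIMSEQ_D[OF w[unfolded well_approximated_def], of "r / 2" n] \<open>r > 0\<close> by fastforce
  have "step_error N h < r" if "N \<ge> max 1 N0" for N
  proof -
    have N: "N > 0" using that by simp
    have d: "integrable lborel (\<lambda>y. h y - s n y)" "\<And>y. y \<notin> unit_ivl \<Longrightarrow> h y - s n y = 0"
      using h s by auto
    have "step_error N h \<le> step_error N (s n) + step_error N (\<lambda>y. h y - s n y)"
      using step_error_add[OF N s(1)[of n] s(2)[of _ n] d] by simp
    then show ?thesis
      using step_error_le[OF N d] N0[of N] that n by simp
  qed
  then show "\<exists>no. \<forall>N\<ge>no. norm (step_error N h - 0) < r"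
    by (intro exI[of _ "max 1 N0"]) (auto simp: step_error_nonneg)
qed

lemma cell_dist:
  assumes N: "N > 0" and x: "x \<in> cell N (\<lfloor>3 * real N * y\<rfloor>) \<or> x \<in> cell N (\<lfloor>3 * real N * y\<rfloor> + 1)"
  shows "\<bar>x - y\<bar> \<le> 2 / (3 * real N)"
proof -
  have "\<bar>3 * real N * x - 3 * real N * y\<bar> \<le> 2" using x unfolding cell_def mem_Collect_eq by linarith
  then have "3 * real N * \<bar>x - y\<bar> \<le> 2"
    by (simp add: abs_mult right_diff_distrib[symmetric])
  then show ?thesis using N by (simp add: field_simps)
qed

lemma avg_close:
  assumes N: "N > 0" and h: "integrable lborel h"
    and k: "\<And>y. y \<in> cell N j \<Longrightarrow> \<bar>h y - k\<bar> \<le> e"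
  shows "\<bar>avg N h j - k\<bar> \<le> e"
proof -
  have const_int[simp]: "integrable lborel (\<lambda>y. indicator (cell N j) y * (c::real))" for c
    using N by (simp add: measure_cell)
  have const: "(LINT y|lborel. indicator (cell N j) y * c) = c / (3 * real N)" for c
    using N by (simp add: measure_cell)
  have "avg N h j - k = 3 * real N * ((LINT y|lborel. indicator (cell N j) y * h y) - (LINT y|lborel. indicator (cell N j) y * k))"
    using N unfolding const by (simp add: avg_def right_diff_distrib)
  also have "\<dots> = 3 * real N * (LINT y|lborel. indicator (cell N j) y * (h y - k))"
    unfolding right_diff_distrib[of "indicator _ _"]
    by (simp only: Bochner_Integration.integral_diff[OF integrable_cell[OF h] const_int])
  finally have "\<bar>avg N h j - k\<bar> = 3 * real N * \<bar>LINT y|lborel. indicator (cell N j) y * (h y - k)\<bar>"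
    by (simp add: abs_mult)
  also have "\<dots> \<le> 3 * real N * (LINT y|lborel. indicator (cell N j) y * e)"
  proof (rule mult_left_mono)
    have "\<bar>LINT y|lborel. indicator (cell N j) y * (h y - k)\<bar>
        \<le> (LINT y|lborel. \<bar>indicator (cell N j) y * (h y - k)\<bar>)"
      by (rule integral_abs_bound)
    also have "\<dots> \<le> (LINT y|lborel. indicator (cell N j) y * e)"
    proof (rule integral_mono)
      show "integrable lborel (\<lambda>y. \<bar>indicator (cell N j) y * (h y - k)\<bar>)"
        unfolding right_diff_distrib[of "indicator _ _"]
        by (intro integrable_abs Bochner_Integration.integrable_diff integrable_cell[OF h] const_int)
      show "\<bar>indicator (cell N j) y * (h y - k)\<bar> \<le> indicator (cell N j) y * e" for y
        using k[of y] by (simp add: indicator_def)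
    qed (rule const_int)
    finally show "\<bar>LINT y|lborel. indicator (cell N j) y * (h y - k)\<bar> \<le> (LINT y|lborel. indicator (cell N j) y * e)" .
  qed simp
  also have "\<dots> = e" using N unfolding const by simp
  finally show ?thesis .
qed

lemma step_tendsto_if_locally_constant:
  assumes \<delta>: "\<delta> > 0" and c: "\<And>x. \<bar>x - y\<bar> < \<delta> \<Longrightarrow> h x = h y"
  shows "(\<lambda>N. step N h y) \<longlonglongrightarrow> h y"
proof -
  have "(\<lambda>N. 2 / (3 * real N)) \<longlonglongrightarrow> 0" by real_asymp
  then have "\<forall>\<^sub>F N in sequentially. 2 / (3 * real N) < \<delta>"
    using \<delta> order_tendstoD(2) by blast
  then have close: "\<forall>\<^sub>F N in sequentially. norm (step N h y - h y) \<le> \<bar>h y\<bar> * (1 / real N)"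
    using eventually_gt_at_top[of 0]
  proof eventually_elim
    case (elim N)
    let ?j = "\<lfloor>3 * real N * y\<rfloor>"
    have "avg N h j = h y" if "j = ?j \<or> j = ?j + 1" for j
    proof -
      have "(LINT x|lborel. indicator (cell N j) x * h x) = (LINT x|lborel. indicator (cell N j) x * h y)"
      proof (rule Bochner_Integration.integral_cong[OF refl])
        fix x
        show "indicator (cell N j) x * h x = indicator (cell N j) x * h y"
        proof (cases "x \<in> cell N j")
          case True
          then have "\<bar>x - y\<bar> \<le> 2 / (3 * real N)"
            using that by (intro cell_dist[OF elim(2)]) auto
          then have "\<bar>x - y\<bar> < \<delta>" using elim(1) by linarith
          from c[OF this] show ?thesis by simp
        qed simp
      qed
      then show ?thesis using elim(2) by (simp add: avg_def measure_cell)
    qed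
    \<comment> \<open>The two weights in \<open>coef\<close> do not sum to 1; their defect is one
      increment of \<open>shift_prob\<close>, hence at most 1 / N.\<close>
    then have "step N h y - h y = h y * (shift_prob N (?j + 1) - shift_prob N ?j)"
      by (simp add: step_def coef_def algebra_simps)
    also have "\<bar>\<dots>\<bar> \<le> \<bar>h y\<bar> * (1 / real N)"
      using shift_prob_Suc[of N ?j] by (simp add: abs_mult mult_left_mono del: times_divide_eq_right)
    finally show ?case by (simp only: real_norm_def)
  qed
  have "(\<lambda>N. \<bar>h y\<bar> * (1 / real N)) \<longlonglongrightarrow> 0" by real_asymp
  with close have "(\<lambda>N. step N h y - h y) \<longlonglongrightarrow> 0"
    by (rule Lim_null_comparison)
  then show ?thesis by (rule LIM_zero_cancel)
qed

text \<open>The indicator is locally constant off two points, so \<open>step\<close> converges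
  almost everywhere, and dominated convergence applies.\<close>

lemma well_approximated_interval: "well_approximated (indicator ({a..b} \<inter> unit_ivl))"
proof -
  define h :: "real \<Rightarrow> real" where "h = indicator ({a..b} \<inter> unit_ivl)"
  define I where "I = {max a 0..min b 1}"
  have I: "h = indicator I" by (auto simp: h_def I_def fun_eq_iff indicator_def)
  have hi: "integrable lborel h" "\<And>y. y \<notin> unit_ivl \<Longrightarrow> h y = 0"
    unfolding I by (auto simp: I_def emeasure_lborel_Icc_eq intro!: integrable_real_indicator)
  have conv: "(\<lambda>N. step N h y) \<longlonglongrightarrow> h y" if "y \<noteq> max a 0" "y \<noteq> min b 1" for y
  proof (rule step_tendsto_if_locally_constant)
    show "min \<bar>y - max a 0\<bar> \<bar>y - min b 1\<bar> > 0" using that by auto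
    fix x assume "\<bar>x - y\<bar> < min \<bar>y - max a 0\<bar> \<bar>y - min b 1\<bar>"
    then have "x \<in> I \<longleftrightarrow> y \<in> I" unfolding I_def atLeastAtMost_iff by linarith
    then show "h x = h y" by (simp add: I indicator_def)
  qed
  \<comment> \<open>Both weights in \<open>coef\<close> and the averages are at most 1, so
    \<open>step\<close> is bounded by 2 and the error by 3. \<open>Suc N\<close> keeps the number of
    cells positive.\<close>
  have bound: "\<bar>step (Suc N) h y - h y\<bar> \<le> 3 * indicator unit_ivl y" for N y
  proof (cases "y \<in> unit_ivl")
    case True
    have "\<bar>avg (Suc N) h j - 0\<bar> \<le> 1" for j
      by (rule avg_close[OF _ hi(1)]) (auto simp: I indicator_def)
    then have c: "\<bar>coef (Suc N) h j\<bar> \<le> (1 - shift_prob (Suc N) j) * 1 + shift_prob (Suc N) (j + 1) * 1" for j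
      using shift_prob_bounds[of "Suc N"]
      by (intro abs_coef_le[THEN order_trans] add_mono mult_left_mono) auto
    have "\<bar>coef (Suc N) h j\<bar> \<le> 2" for j
      using c[of j] shift_prob_bounds[of "Suc N" j] shift_prob_bounds[of "Suc N" "j + 1"]
      unfolding mult_1_right by linarith
    then have "\<bar>step (Suc N) h y\<bar> \<le> 2" by (simp only: step_def)
    moreover have "\<bar>h y\<bar> \<le> 1" by (simp add: I indicator_def)
    ultimately have "\<bar>step (Suc N) h y - h y\<bar> \<le> 3" by linarith
    then show ?thesis using True by (simp only: indicator_simps mult_1_right)
  next
    case False
    then have "step (Suc N) h y = 0" "h y = 0"
      using step_outside[of "Suc N" h y] hi(2) by blast+
    then show ?thesis by simp
  qed
  have [measurable]: "h \<in> borel_measurable lborel" "step (Suc N) h \<in> borel_measurable lborel" for N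
    using borel_measurable_integrable[OF hi(1)]
      borel_measurable_integrable[OF integrable_step[of "Suc N" h]] hi(2) by blast+
  have "(\<lambda>N. LINT y|lborel. \<bar>step (Suc N) h y - h y\<bar>) \<longlonglongrightarrow> (LINT y::real|lborel. 0)"
  proof (rule integral_dominated_convergence[where w="\<lambda>y. 3 * indicator unit_ivl y"])
    show "AE y in lborel. (\<lambda>N. \<bar>step (Suc N) h y - h y\<bar>) \<longlonglongrightarrow> 0"
      using AE_lborel_singleton[of "max a 0"] AE_lborel_singleton[of "min b 1"]
    proof eventually_elim
      case (elim y)
      have "(\<lambda>N. \<bar>step N h y - h y\<bar>) \<longlonglongrightarrow> \<bar>h y - h y\<bar>"
        by (rule tendsto_rabs[OF tendsto_diff[OF conv[OF elim] tendsto_const]])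
      from LIMSEQ_Suc[OF this] show ?case by simp
    qed
    show "AE y in lborel. norm \<bar>step (Suc N) h y - h y\<bar> \<le> 3 * indicator unit_ivl y" for N
      by (intro AE_I2) (simp only: real_norm_def abs_idempotent bound)
    show "(\<lambda>y. \<bar>step (Suc N) h y - h y\<bar>) \<in> borel_measurable lborel" for N
      by measurable
  qed simp_all
  then have "(\<lambda>N. step_error (Suc N) h) \<longlonglongrightarrow> 0" by (simp add: step_error_def)
  then show ?thesis unfolding well_approximated_def h_def[symmetric] by (rule LIMSEQ_imp_Suc)
qed

lemma integrable_indicator_unit:
  "A \<in> sets borel \<Longrightarrow> integrable lborel (indicator (A \<inter> unit_ivl) :: real \<Rightarrow> real)"
proof -
  assume "A \<in> sets borel"
  moreover have "emeasure lborel (A \<inter> unit_ivl) \<le> emeasure lborel unit_ivl"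
    by (intro emeasure_mono) auto
  then have "emeasure lborel (A \<inter> unit_ivl) < \<top>" by (rule le_less_trans) simp
  ultimately show ?thesis by (auto intro!: integrable_real_indicator)
qed

lemma well_approximated_empty: "well_approximated (indicator ({} \<inter> unit_ivl))"
proof -
  have "{1..0::real} = {}" by simp
  from well_approximated_interval[of 1 0, unfolded this] show ?thesis .
qed

lemma well_approximated_indicator:
  assumes "A \<in> sets borel"
  shows "well_approximated (indicator (A \<inter> unit_ivl))"
  using assms
proof (induction A rule: borel_set_induct)
  case empty
  show ?case by (rule well_approximated_empty)
next
  case (interval a b)
  show ?case by (rule well_approximated_interval)
next
  case (compl A)
  have "well_approximated (\<lambda>y. indicator ({0..1} \<inter> unit_ivl) y + (- 1) * indicator (A \<inter> unit_ivl) y)"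
    using compl integrable_indicator_unit[of A] integrable_indicator_unit[of "{0..1}"]
    by (intro well_approximated_add well_approximated_cmult well_approximated_interval) auto
  moreover have "(\<lambda>y. indicator ({0..1} \<inter> unit_ivl) y + (- 1) * indicator (A \<inter> unit_ivl) y)
      = (indicator (- A \<inter> unit_ivl) :: real \<Rightarrow> real)"
    by (auto simp: fun_eq_iff indicator_def)
  ultimately show ?case by simp
next
  case (union f)
  define s :: "nat \<Rightarrow> real \<Rightarrow> real" where "s n = indicator ((\<Union>i<n. f i) \<inter> unit_ivl)" for n
  have un: "(\<Union>i<n. f i) \<in> sets borel" for n using union by auto
  have U: "(\<Union>i. f i) \<in> sets borel" using union by auto
  have w: "well_approximated (s n)" for n
  proof (induction n)
    case 0
    have "(\<Union>i<0. f i) = {}" by simp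
    then show ?case unfolding s_def by (simp only: well_approximated_empty)
  next
    case (Suc n)
    have "s (Suc n) = (\<lambda>y. s n y + indicator (f n \<inter> unit_ivl) y)"
    proof
      fix y
      have "y \<notin> (\<Union>i<n. f i)" if "y \<in> f n"
        using union(1) that unfolding disjoint_family_on_def by (metis UNIV_I UN_iff disjoint_iff lessThan_iff less_irrefl)
      then show "s (Suc n) y = s n y + indicator (f n \<inter> unit_ivl) y"
        by (auto simp: s_def indicator_def less_Suc_eq)
    qed
    then show ?case
      using Suc union integrable_indicator_unit[OF un] integrable_indicator_unit[OF union(2)]
      by (simp only:, intro well_approximated_add) (auto simp: s_def)
  qed
  show ?case
  proof (rule well_approximated_lim[of _ s])
    show "integrable lborel (indicator ((\<Union>i. f i) \<inter> unit_ivl) :: real \<Rightarrow> real)"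
      by (rule integrable_indicator_unit[OF U])
    show "integrable lborel (s n)" for n
      unfolding s_def by (rule integrable_indicator_unit[OF un])
    show "(\<lambda>n. LINT y|lborel. \<bar>indicator ((\<Union>i. f i) \<inter> unit_ivl) y - s n y\<bar>) \<longlonglongrightarrow> 0"
    proof -
      have "(\<lambda>n. LINT y|lborel. \<bar>indicator ((\<Union>i. f i) \<inter> unit_ivl) y - s n y\<bar>) \<longlonglongrightarrow> (LINT y::real|lborel. 0)"
      proof (rule integral_dominated_convergence[where w="indicator unit_ivl"])
        show "AE y in lborel. (\<lambda>n. \<bar>indicator ((\<Union>i. f i) \<inter> unit_ivl) y - s n y\<bar>) \<longlonglongrightarrow> 0"
        proof (rule AE_I2)
          fix y :: real
          have "(\<lambda>n. indicator (\<Union>i<n. f i) y * indicator unit_ivl y :: real)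
              \<longlonglongrightarrow> indicator (\<Union>i. f i) y * indicator unit_ivl y"
            by (intro tendsto_intros LIMSEQ_indicator_UN)
          then have "(\<lambda>n. s n y) \<longlonglongrightarrow> indicator ((\<Union>i. f i) \<inter> unit_ivl) y"
            unfolding s_def indicator_inter_arith .
          from tendsto_rabs[OF tendsto_diff[OF tendsto_const this, of "indicator ((\<Union>i. f i) \<inter> unit_ivl) y"]]
          show "(\<lambda>n. \<bar>indicator ((\<Union>i. f i) \<inter> unit_ivl) y - s n y\<bar>) \<longlonglongrightarrow> 0" by simp
        qed
        show "(\<lambda>y. \<bar>indicator ((\<Union>i. f i) \<inter> unit_ivl) y - s n y\<bar>) \<in> borel_measurable lborel" for n
          unfolding s_def using integrable_indicator_unit[OF U] integrable_indicator_unit[OF un]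
          by (intro borel_measurable_abs borel_measurable_diff borel_measurable_integrable)
      qed (auto simp: s_def indicator_def)
      then show ?thesis by simp
    qed
  qed (use w in \<open>auto simp: s_def\<close>)
qed

lemma well_approximated_integrable:
  assumes "integrable leb h"
  shows "well_approximated (zext h)"
  using assms
proof (induction rule: integrable_induct)
  case (base A c)
  then have A: "A \<subseteq> unit_ivl" "A \<in> sets borel" by (auto simp: sets_restrict_space_iff)
  have "zext (\<lambda>x. indicator A x *\<^sub>R c) = (\<lambda>x. c * indicator (A \<inter> unit_ivl) x)"
    by (auto simp: fun_eq_iff indicator_def)
  then show ?case
    using well_approximated_cmult[OF well_approximated_indicator[OF A(2)]] by simp
next
  case (add f g)
  have "zext (\<lambda>x. f x + g x) = (\<lambda>x. zext f x + zext g x)"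
    by (auto simp: fun_eq_iff distrib_left)
  then show ?case
    using add unfolding integrable_leb by (simp only:, intro well_approximated_add) auto
next
  case (lim f s)
  show ?case
  proof (rule well_approximated_lim[of _ "\<lambda>n. zext (s n)"])
    show "integrable lborel (zext f)" "integrable lborel (zext (s n))" for n
      using lim by (simp_all add: integrable_leb)
    then have [measurable]: "zext f \<in> borel_measurable lborel" "zext (s n) \<in> borel_measurable lborel" for n
      by auto
    have "(\<lambda>n. LINT y|lborel. \<bar>zext f y - zext (s n) y\<bar>) \<longlonglongrightarrow> (LINT y::real|lborel. 0)"
    \<comment> \<open>The induction rule supplies the bound of \<open>s n\<close> by twice
      \<open>f\<close>, which makes three times \<open>f\<close> a majorant of the
      difference.\<close>
    proof (rule integral_dominated_convergence[where w="\<lambda>y. 3 * \<bar>zext f y\<bar>"])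
      show "integrable lborel (\<lambda>y. 3 * \<bar>zext f y\<bar>)"
        using lim by (simp add: integrable_leb)
      show "AE y in lborel. (\<lambda>n. \<bar>zext f y - zext (s n) y\<bar>) \<longlonglongrightarrow> 0"
      proof (rule AE_I2)
        fix y :: real
        have "(\<lambda>n. zext (s n) y) \<longlonglongrightarrow> zext f y"
          using lim(2)[of y] by (cases "y \<in> unit_ivl") (auto simp: space_restrict_space)
        from tendsto_rabs[OF tendsto_diff[OF tendsto_const this, of "zext f y"]]
        show "(\<lambda>n. \<bar>zext f y - zext (s n) y\<bar>) \<longlonglongrightarrow> 0" by simp
      qed
      show "AE y in lborel. norm \<bar>zext f y - zext (s n) y\<bar> \<le> 3 * \<bar>zext f y\<bar>" for n
      proof (rule AE_I2)
        fix y :: real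
        show "norm \<bar>zext f y - zext (s n) y\<bar> \<le> 3 * \<bar>zext f y\<bar>"
          using lim(3)[of y n] by (cases "y \<in> unit_ivl") (auto simp: space_restrict_space)
      qed
    qed auto
    then show "(\<lambda>n. LINT y|lborel. \<bar>zext f y - zext (s n) y\<bar>) \<longlonglongrightarrow> 0" by simp
  qed (use lim in auto)
qed

subsection \<open>The induced chain on cells\<close>

text \<open>Since \<open>wmap\<close> only takes values \<open>\<ge> 1/3\<close>, the shift always takes place. The uniform distribution on
  cell \<open>i\<close> thus goes to the average of those on the cells \<open>next_cell N i\<close> and \<open>next_cell N i - 1\<close>.\<close>

definition next_cell :: "nat \<Rightarrow> int \<Rightarrow> int" where
  "next_cell N i = (if i < int N then int N else if i < 2 * int N then 2 * i - int N else 2 * i - 3 * int N)"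

text \<open>The transition operator acting on observables rather than on distributions:
  \<open>(chain N ^^ n) v i\<close> is the expectation of \<open>v\<close> after n steps from cell
  i.\<close>

definition chain :: "nat \<Rightarrow> (int \<Rightarrow> real) \<Rightarrow> int \<Rightarrow> real" where
  "chain N v i = (v (next_cell N i) + v (next_cell N i - 1)) / 2"

text \<open>Images under \<open>wmap\<close> lie in cell N or further right, and the shift subtracts
  one; cell N - 1 is thus the only state left of 1/3.\<close>

abbreviation chain_states :: "nat \<Rightarrow> int set" where
  "chain_states N \<equiv> {int N - 1..<3 * int N}"

lemma next_cell_states:
  assumes "N > 0" "i \<in> chain_states N"
  shows "next_cell N i \<in> chain_states N" "next_cell N i - 1 \<in> chain_states N"
  using assms by (auto simp: next_cell_def)

lemma chain_pow_Suc:
  "(chain N ^^ Suc n) u i = ((chain N ^^ n) u (next_cell N i) + (chain N ^^ n) u (next_cell N i - 1)) / 2"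
  by (subst funpow.simps(2), subst comp_apply, rule chain_def)

lemma chain_pow_bounded:
  assumes N: "N > 0" and u: "\<And>i. i \<in> chain_states N \<Longrightarrow> \<bar>u i\<bar> \<le> B" and i: "i \<in> chain_states N"
  shows "\<bar>(chain N ^^ n) u i\<bar> \<le> B"
  using i
proof (induction n arbitrary: i)
  case (Suc n)
  show ?case
    using Suc.IH[OF next_cell_states(1)[OF N Suc.prems]] Suc.IH[OF next_cell_states(2)[OF N Suc.prems]]
    by (simp add: chain_def)
qed (use u in auto)

text \<open>Both trap cells have \<open>next_cell\<close> equal to N, so the successors of either
  one are N and N - 1 again.\<close>

lemma chain_pow_trap:
  assumes N: "N > 0" and u: "u (int N) = 0" "u (int N - 1) = 0"
  shows "(chain N ^^ n) u (int N) = 0 \<and> (chain N ^^ n) u (int N - 1) = 0"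
  using N u by (induction n) (auto simp: chain_def next_cell_def)

text \<open>Relative to the turning point at cell \<open>N\<close>, \<open>next_cell N\<close> is doubling modulo \<open>2 * N\<close>. Hence the path
  that always chooses \<open>next_cell\<close> leads to cell \<open>N\<close> after \<open>r\<close> steps; it has weight \<open>(1/2)^r\<close>.\<close>

lemma chain_pow_contracts:
  assumes N: "N > 0" and u: "u (int N) = 0" "\<And>i. i \<in> chain_states N \<Longrightarrow> \<bar>u i\<bar> \<le> B"
    and i: "i \<in> chain_states N" "2 * int N dvd 2 ^ r * (i - int N)"
  shows "\<bar>(chain N ^^ r) u i\<bar> \<le> B * (1 - (1/2) ^ r)"
  using i
proof (induction r arbitrary: i)
  case 0
  then have "i - int N = 0"
  proof -
    from 0 obtain k where k: "i - int N = 2 * int N * k" by (auto elim: dvdE)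
    \<comment> \<open>The offsets of states from N range from -1 to 2 * N - 1, where the only
      multiple of 2 * N is 0.\<close>
    have "-1 \<le> 2 * int N * k" "2 * int N * k < 2 * int N" using 0(1) k by auto
    then have "k = 0"
      using N by (smt (verit) mult_le_cancel_left1 mult_minus_right nat_int_comparison(2) of_nat_0 zero_less_imp_eq_int)
    then show ?thesis using k by simp
  qed
  then show ?case using u(1) by simp
next
  case (Suc r)
  let ?j = "next_cell N i"
  have "2 * int N dvd 2 ^ r * (?j - int N)"
  proof (cases "i < int N")
    case False
    then have "?j - int N = 2 * (i - int N) \<or> ?j - int N = 2 * (i - int N) - 2 * int N"
      by (auto simp: next_cell_def)
    moreover have "2 ^ r * (2 * (i - int N)) = 2 ^ Suc r * (i - int N)" by simp
    with Suc.prems(2) have d: "2 * int N dvd 2 ^ r * (2 * (i - int N))" by (simp only:)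
    moreover have "2 * int N dvd 2 ^ r * (2 * (i - int N) - 2 * int N)"
      using dvd_diff[OF d dvd_triv_right[of "2 * int N" "2 ^ r"]] by (simp only: right_diff_distrib)
    ultimately show ?thesis by metis
  qed (simp add: next_cell_def)
  then have "\<bar>(chain N ^^ r) u ?j\<bar> \<le> B * (1 - (1/2) ^ r)"
    using Suc.IH next_cell_states(1)[OF N Suc.prems(1)] by blast
  moreover have "\<bar>(chain N ^^ r) u (?j - 1)\<bar> \<le> B"
    using chain_pow_bounded[OF N u(2) next_cell_states(2)[OF N Suc.prems(1)]] .
  ultimately have "\<bar>(chain N ^^ r) u ?j + (chain N ^^ r) u (?j - 1)\<bar> \<le> B * (1 - (1/2) ^ r) + B"
    by linarith
  then have "\<bar>((chain N ^^ r) u ?j + (chain N ^^ r) u (?j - 1)) / 2\<bar> \<le> B * (1 - (1/2) ^ r / 2)"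
    by (simp add: right_diff_distrib)
  then show ?case unfolding chain_pow_Suc by simp
qed

text \<open>Because 2 ^ (m + 1) = 2 * N, a block of m + 1 steps contracts by the same factor
  \<theta> from every state. The values on the trap remain 0, so the blocks can be iterated;
  incomplete blocks do not increase the bound.\<close>

lemma chain_pow_to_zero:
  assumes N: "N = 2 ^ m" and u: "u (int N) = 0" "u (int N - 1) = 0"
    and B: "\<And>i. i \<in> chain_states N \<Longrightarrow> \<bar>u i\<bar> \<le> B" and e: "e > 0"
  shows "\<exists>n0. \<forall>n\<ge>n0. \<forall>i\<in>chain_states N. \<bar>(chain N ^^ n) u i\<bar> \<le> e"
proof -
  have N0: "N > 0" using N by simp
  define \<theta> :: real where "\<theta> = 1 - (1/2) ^ Suc m"
  have \<theta>: "0 \<le> \<theta>" "\<theta> < 1" by (simp_all add: \<theta>_def power_le_one del: power_Suc)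
  have pow: "\<bar>(chain N ^^ (k * Suc m)) u i\<bar> \<le> B * \<theta> ^ k" if "i \<in> chain_states N" for k i
    using that
  proof (induction k arbitrary: i)
    case 0
    then show ?case using B by simp
  next
    case (Suc k)
    have "int (2 * N) dvd 2 ^ Suc m * (i - int N)" for i
      unfolding N by simp
    then have "\<bar>(chain N ^^ Suc m) ((chain N ^^ (k * Suc m)) u) i\<bar> \<le> (B * \<theta> ^ k) * (1 - (1/2) ^ Suc m)"
      using chain_pow_trap[OF N0 u] Suc
      by (intro chain_pow_contracts N0) auto
    moreover have "Suc k * Suc m = Suc m + k * Suc m" by simp
    then have "(chain N ^^ (Suc k * Suc m)) u i = (chain N ^^ Suc m) ((chain N ^^ (k * Suc m)) u) i"
      by (simp only: funpow_add comp_apply)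
    moreover have "(B * \<theta> ^ k) * (1 - (1/2) ^ Suc m) = B * \<theta> ^ Suc k"
      unfolding \<theta>_def[symmetric] by simp
    ultimately show ?case by (simp only:)
  qed
  have "(\<lambda>k. B * \<theta> ^ k) \<longlonglongrightarrow> 0"
    using \<theta> by (intro tendsto_mult_right_zero LIMSEQ_realpow_zero) auto
  then obtain k where k: "B * \<theta> ^ k < e"
    using order_tendstoD(2)[OF _ e] eventually_sequentially by (metis order_refl)
  have "\<bar>(chain N ^^ n) u i\<bar> \<le> e" if "n \<ge> k * Suc m" "i \<in> chain_states N" for n i
  proof -
    have "n = (n - k * Suc m) + k * Suc m" using that(1) by simp
    then have "(chain N ^^ n) u i = (chain N ^^ (n - k * Suc m)) ((chain N ^^ (k * Suc m)) u) i"
      by (metis comp_apply funpow_add)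
    also have "\<bar>\<dots>\<bar> \<le> B * \<theta> ^ k"
      by (rule chain_pow_bounded[OF N0 pow that(2)])
    finally show ?thesis using k by simp
  qed
  then show ?thesis by blast
qed

lemma chain_pow_converges:
  assumes N: "N = 2 ^ m" and B: "\<And>i. i \<in> chain_states N \<Longrightarrow> \<bar>v i\<bar> \<le> B" and e: "e > 0"
  shows "\<exists>n0. \<forall>n\<ge>n0. \<forall>i\<in>chain_states N.
    \<bar>(chain N ^^ n) v i - (v (int N) + v (int N - 1)) / 2\<bar> \<le> e"
proof -
  have N0: "N > 0" using N by simp
  define \<rho> where "\<rho> = (v (int N) + v (int N - 1)) / 2"
  \<comment> \<open>One step is taken first: \<open>v\<close> may differ on the two trap cells,
    whereas \<open>chain N v\<close> equals \<rho> on both. Subtracting the constant \<rho> commutes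
    with \<open>chain\<close>.\<close>
  define u where "u i = chain N v i - \<rho>" for i
  have trap: "u (int N) = 0" "u (int N - 1) = 0"
    using N0 by (auto simp: u_def chain_def next_cell_def \<rho>_def)
  have "\<bar>u i\<bar> \<le> 2 * B" if "i \<in> chain_states N" for i
  proof -
    have "int N \<in> chain_states N" "int N - 1 \<in> chain_states N" using N0 by auto
    from this[THEN B] have "\<bar>v (int N) + v (int N - 1)\<bar> \<le> 2 * B" by linarith
    then have "\<bar>\<rho>\<bar> \<le> B" unfolding \<rho>_def by simp
    moreover have "\<bar>chain N v i\<bar> \<le> B" using chain_pow_bounded[OF N0 B that, where n = 1] by simp
    ultimately show ?thesis unfolding u_def by linarith
  qed
  from chain_pow_to_zero[OF N trap this e]
  obtain n0 where n0: "\<forall>n\<ge>n0. \<forall>i\<in>chain_states N. \<bar>(chain N ^^ n) u i\<bar> \<le> e" ..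
  have shift: "(chain N ^^ Suc n) v i = (chain N ^^ n) u i + \<rho>" for n i
  proof (induction n arbitrary: i)
    case (Suc n)
    have "(chain N ^^ Suc (Suc n)) v i
        = ((chain N ^^ Suc n) v (next_cell N i) + (chain N ^^ Suc n) v (next_cell N i - 1)) / 2"
      by (rule chain_pow_Suc)
    also have "\<dots> = ((chain N ^^ n) u (next_cell N i) + (chain N ^^ n) u (next_cell N i - 1)) / 2 + \<rho>"
      unfolding Suc by simp
    also have "\<dots> = (chain N ^^ Suc n) u i + \<rho>"
      by (simp only: chain_pow_Suc[of n N u])
    finally show ?case .
  qed (simp add: u_def)
  have "\<forall>i\<in>chain_states N. \<bar>(chain N ^^ n) v i - \<rho>\<bar> \<le> e" if "n \<ge> Suc n0" for n
  proof -
    obtain k where k: "n = Suc k" using Suc_le_D[OF \<open>Suc n0 \<le> n\<close>] by blast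
    show ?thesis using n0 that unfolding k shift by simp
  qed
  then show ?thesis unfolding \<rho>_def by blast
qed

section \<open>From the map to the chain: images of half cells\<close>

lemma wmap_scaled:
  assumes "N > 0"
  shows "3 * real N * wmap y = (if 3 * real N * y < real N then 3 * real N - 2 * (3 * real N * y)
    else if 3 * real N * y < 2 * real N then 2 * (3 * real N * y) - real N else 2 * (3 * real N * y) - 3 * real N)"
proof -
  have "y < 1/3 \<longleftrightarrow> 3 * real N * y < real N" "y < 2/3 \<longleftrightarrow> 3 * real N * y < 2 * real N"
    using assms by (auto simp: field_simps)
  then show ?thesis by (simp add: wmap_def algebra_simps)
qed

text \<open>The cell over which the image of \<open>x\<close> under the perturbed map is uniformly distributed.\<close>

definition target :: "nat \<Rightarrow> real \<Rightarrow> int" where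
  "target N x = \<lfloor>3 * real N * wmap x\<rfloor> - 1"

lemma target_states:
  assumes "N > 0" "x \<in> unit_ivl"
  shows "target N x \<in> chain_states N"
proof -
  have "1/3 \<le> wmap x" "wmap x \<le> 1" using assms(2) by (auto simp: wmap_def)
  then have "3 * real N * (1/3) \<le> 3 * real N * wmap x" "3 * real N * wmap x \<le> 3 * real N * 1"
    using assms(1) by (intro mult_left_mono; simp)+
  then have "int N \<le> \<lfloor>3 * real N * wmap x\<rfloor>" "\<lfloor>3 * real N * wmap x\<rfloor> \<le> 3 * int N"
    by (simp_all add: le_floor_iff floor_le_iff)
  then show ?thesis by (auto simp: target_def)
qed

lemma target_measurable: "target N \<in> leb \<rightarrow>\<^sub>M count_space UNIV"
proof -
  have "target N \<in> borel \<rightarrow>\<^sub>M count_space UNIV"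
    unfolding target_def[abs_def] wmap_def[abs_def] by measurable
  then show ?thesis by (simp add: measurable_restrict_space1)
qed

lemma target_function_measurable:
  fixes v :: "int \<Rightarrow> real"
  shows "(\<lambda>x. v (target N x)) \<in> borel_measurable leb"
  by (rule measurable_compose[OF target_measurable]) simp

lemma target_turning_point: "N > 0 \<Longrightarrow> target N (1/3) = int N - 1"
  by (simp add: target_def wmap_def)

lemma integral_pert_wmap:
  fixes \<phi> :: "real \<Rightarrow> real"
  assumes N: "N > 0" and x: "x \<in> unit_ivl" and [measurable]: "\<phi> \<in> borel_measurable leb"
  shows "(LINT y|pert N (wmap x). \<phi> y) = avg N (zext \<phi>) (target N x)"
proof -
  define i where "i = \<lfloor>3 * real N * wmap x\<rfloor>"
  have "int N \<le> i" using target_states[OF N x] by (simp add: target_def i_def)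
  \<comment> \<open>From cell N on the shift is certain, so the law is uniform on the single cell i
    - 1.\<close>
  then have p: "shift_prob N i = 1" using N by (simp add: shift_prob_1)
  have kd: "kernel_density N (wmap x) y = 3 * real N * indicator (cell N (i - 1)) y" for y
    unfolding kernel_density_def Let_def i_def[symmetric] p by simp
  have "(LINT y|pert N (wmap x). \<phi> y) = (LINT y|leb. kernel_density N (wmap x) y *\<^sub>R \<phi> y)"
    unfolding pert_def
    by (rule integral_density) (auto simp: kernel_density_nonneg)
  also have "\<dots> = (LINT y|lborel. 3 * real N * (indicator (cell N (i - 1)) y * zext \<phi> y))"
    unfolding integral_leb kd
    by (intro Bochner_Integration.integral_cong) simp_all
  also have "\<dots> = avg N (zext \<phi>) (target N x)"
    by (simp only: integral_mult_right_zero avg_def target_def i_def)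
  finally show ?thesis .
qed

text \<open>The parameter \<open>e\<close> selects a half of cell i: 0 is the left one, 1 the right
  one. Slope 2 stretches a half cell to a whole one. For i = N - 1 the branch reverses orientation,
  which exchanges the two images. The strict inequalities leave out the end points of the half
  cells.\<close>

lemma target_eq:
  assumes N: "N > 0" and i: "i \<in> chain_states N" and e: "0 \<le> e" "e \<le> 1"
    and y: "of_int i + of_int e / 2 < 3 * real N * y" "3 * real N * y < of_int i + (of_int e + 1) / 2"
  shows "target N y = (if i < int N then next_cell N i - e else next_cell N i - 1 + e)"
proof -
  define t where "t = 3 * real N * y"
  have e': "0 \<le> real_of_int e" "real_of_int e \<le> 1" using e by auto
  then have t: "of_int i < t" "t < of_int i + 1" using y e' unfolding t_def add_divide_distrib by linarith+
  note w = wmap_scaled[OF N, of y, folded t_def] and z = y[folded t_def]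
  consider "i = int N - 1" | "int N \<le> i" "i < 2 * int N" | "2 * int N \<le> i" using i by fastforce
  then show ?thesis
  proof cases
    case 1
    then have r: "real_of_int i = real N - 1" by simp
    then have "3 * real N * wmap y = 3 * real N - 2 * t" using w t by simp
    then have "\<lfloor>3 * real N * wmap y\<rfloor> = int N + 1 - e"
      using z[unfolded add_divide_distrib] r by (intro floor_unique; simp; linarith)
    then show ?thesis using 1 by (simp add: target_def next_cell_def)
  next
    case 2
    then have r: "real N \<le> real_of_int i" "real_of_int i + 1 \<le> 2 * real N" by linarith+
    then have "3 * real N * wmap y = 2 * t - real N" using w t by simp
    then have "\<lfloor>3 * real N * wmap y\<rfloor> = 2 * i - int N + e"
      using z[unfolded add_divide_distrib] r by (intro floor_unique; simp; linarith)
    then show ?thesis using 2 by (simp add: target_def next_cell_def)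
  next
    case 3
    then have r: "2 * real N \<le> real_of_int i" by linarith
    then have "3 * real N * wmap y = 2 * t - 3 * real N" using w t by simp
    then have "\<lfloor>3 * real N * wmap y\<rfloor> = 2 * i - 3 * int N + e"
      using z[unfolded add_divide_distrib] r by (intro floor_unique; simp; linarith)
    then show ?thesis using 3 N by (simp add: target_def next_cell_def)
  qed
qed

text \<open>The two halves of cell i have the targets \<open>next_cell N i\<close> and
  \<open>next_cell N i - 1\<close> in some order, each with weight 1/2. This identity makes the
  reduction to the finite chain exact.\<close>

lemma avg_target:
  assumes N: "N > 0" and i: "i \<in> chain_states N"
  shows "avg N (zext (\<lambda>x. v (target N x))) i = chain N v i"
proof -
  let ?K = "3 * real N"
  define a b m where "a = of_int i / ?K" and "b = (of_int i + 1) / ?K" and "m = (of_int i + 1/2) / ?K"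
  have abm: "a \<le> m" "m \<le> b" using N by (auto simp: a_def b_def m_def divide_right_mono)
  define \<alpha> \<beta> where "\<alpha> = (if i < int N then v (next_cell N i) else v (next_cell N i - 1))"
    and "\<beta> = (if i < int N then v (next_cell N i - 1) else v (next_cell N i))"
  have cell: "cell N i = {a..<b}" using cell_eq[OF N] by (simp add: a_def b_def)
  have i0: "0 \<le> i" "i < 3 * int N" using i N by auto
  have low: "v (target N y) = \<alpha>" if "a < y" "y < m" for y
  proof -
    have "of_int i < ?K * y" "?K * y < of_int i + 1/2"
      using that N by (simp_all add: a_def m_def pos_divide_less_eq pos_less_divide_eq mult.commute)
    then have "target N y = (if i < int N then next_cell N i - 0 else next_cell N i - 1 + 0)"
      by (intro target_eq[OF N i]) simp_all
    then show ?thesis by (simp add: \<alpha>_def)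
  qed
  have high: "v (target N y) = \<beta>" if "m < y" "y < b" for y
  proof -
    have "of_int i + 1/2 < ?K * y" "?K * y < of_int i + 1"
      using that N by (simp_all add: b_def m_def pos_divide_less_eq pos_less_divide_eq mult.commute)
    then have "target N y = (if i < int N then next_cell N i - 1 else next_cell N i - 1 + 1)"
      by (intro target_eq[OF N i]) simp_all
    then show ?thesis by (simp add: \<beta>_def)
  qed
  have sub: "y \<in> unit_ivl" if "y \<in> cell N i" for y
    using cell_subset_unit[OF N i0] that by auto
  have "(LINT y|lborel. indicator (cell N i) y * zext (\<lambda>x. v (target N x)) y)
      = (LINT y|lborel. \<alpha> * indicator {a<..<m} y + \<beta> * indicator {m<..<b} y)"
  proof (rule integral_cong_AE)
    show "AE y in lborel. indicator (cell N i) y * zext (\<lambda>x. v (target N x)) y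
        = \<alpha> * indicator {a<..<m} y + \<beta> * indicator {m<..<b} y"
      using AE_lborel_singleton[of a] AE_lborel_singleton[of m]
    proof eventually_elim
      case (elim y)
      consider "y \<notin> cell N i" | "a < y" "y < m" | "m < y" "y < b"
        using elim unfolding cell by fastforce
      then show ?case
      proof cases
        case 1
        then show ?thesis using abm by (auto simp: cell indicator_def)
      next
        case 2
        then have "y \<in> cell N i" using abm by (simp add: cell)
        with 2 sub[OF this] show ?thesis by (simp add: low)
      next
        case 3
        then have "y \<in> cell N i" using abm by (simp add: cell)
        with 3 sub[OF this] show ?thesis by (simp add: high)
      qed
    qed
    have "(\<lambda>y. indicator unit_ivl y *\<^sub>R v (target N y)) \<in> borel_measurable borel"
      using target_function_measurable[of v N]
      by (subst (asm) borel_measurable_restrict_space_iff) auto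
    then show "(\<lambda>y. indicator (cell N i) y * zext (\<lambda>x. v (target N x)) y) \<in> borel_measurable lborel"
      by simp
  qed auto
  also have "\<dots> = \<alpha> * (m - a) + \<beta> * (b - m)"
    using abm by (subst Bochner_Integration.integral_add) auto
  also have "\<dots> = (\<alpha> + \<beta>) / (2 * ?K)"
  proof -
    have "m - a = 1 / (2 * ?K)" "b - m = 1 / (2 * ?K)"
      using N by (auto simp: a_def b_def m_def field_simps)
    then show ?thesis by (simp add: add_divide_distrib)
  qed
  also have "\<alpha> + \<beta> = 2 * chain N v i" by (auto simp: \<alpha>_def \<beta>_def chain_def)
  finally show ?thesis using N by (simp add: avg_def)
qed

subsection \<open>The perturbed system\<close>

abbreviation evolve :: "nat \<Rightarrow> real measure \<Rightarrow> real measure" where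
  "evolve N \<equiv> perturbed wmap (pert N)"

lemma pert_wmap_measurable:
  assumes "N > 0"
  shows "(\<lambda>x. pert N (wmap x)) \<in> leb \<rightarrow>\<^sub>M prob_algebra leb"
  using transition_prob_pert[OF assms] unfolding transition_prob_def
  by (rule measurable_compose[OF wmap_measurable])

lemma evolve_prob:
  assumes N: "N > 0" and \<mu>: "\<mu> \<in> space (prob_algebra leb)"
  shows "evolve N \<mu> \<in> space (prob_algebra leb)"
proof -
  have "sets (evolve N \<mu>) = sets leb" "prob_space (evolve N \<mu>)"
    unfolding perturbed_def
    using sets_bind'[OF \<mu> pert_wmap_measurable[OF N]] prob_space_bind'[OF \<mu> pert_wmap_measurable[OF N]]
    by auto
  then show ?thesis by (simp add: space_prob_algebra)
qed

lemma evolve_pow_prob: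
  assumes "N > 0" "\<mu> \<in> space (prob_algebra leb)"
  shows "(evolve N ^^ n) \<mu> \<in> space (prob_algebra leb)"
  by (induction n) (use assms evolve_prob in auto)

lemma prob_algebra_leb:
  assumes "\<mu> \<in> space (prob_algebra leb)"
  shows "prob_space \<mu>" "sets \<mu> = sets leb" "space \<mu> = unit_ivl"
  using assms sets_eq_imp_space_eq[of \<mu> leb] by (auto simp: space_prob_algebra space_restrict_space)

text \<open>One step replaces an observable by its cell averages; from then on only the finite chain
  matters.\<close>

lemma integral_evolve:
  fixes \<phi> :: "real \<Rightarrow> real"
  assumes N: "N > 0" and \<mu>: "\<mu> \<in> space (prob_algebra leb)"
    and \<phi>: "\<phi> \<in> borel_measurable leb" "\<And>x. x \<in> unit_ivl \<Longrightarrow> \<bar>\<phi> x\<bar> \<le> B"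
  shows "(LINT x|evolve N \<mu>. \<phi> x) = (LINT x|\<mu>. avg N (zext \<phi>) (target N x))"
proof -
  note \<mu>' = prob_algebra_leb[OF \<mu>]
  have K: "(\<lambda>x. pert N (wmap x)) \<in> \<mu> \<rightarrow>\<^sub>M subprob_algebra leb"
    using measurable_prob_algebraD[OF pert_wmap_measurable[OF N]] measurable_cong_sets[OF \<mu>'(2) refl] by blast
  have "(LINT x|evolve N \<mu>. \<phi> x) = (LINT x|\<mu>. LINT y|pert N (wmap x). \<phi> y)"
    unfolding perturbed_def
  proof (rule integral_bind[OF \<phi>(1) _ K, where B = B and B' = 1])
    show "finite_measure \<mu>" using \<mu>'(1) by (simp add: prob_space.finite_measure)
    show "AE x in \<mu>. emeasure (pert N (wmap x)) (space (pert N (wmap x))) \<le> ennreal 1"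
    proof (rule AE_I2)
      fix x assume "x \<in> space \<mu>"
      then have "wmap x \<in> unit_ivl" using wmap_unit \<mu>'(3) by auto
      then interpret prob_space "pert N (wmap x)" using prob_space_pert[OF N] by blast
      show "emeasure (pert N (wmap x)) (space (pert N (wmap x))) \<le> ennreal 1"
        unfolding emeasure_space_1 by simp
    qed
  qed (use \<phi>(2) in \<open>auto simp: space_restrict_space\<close>)
  also have "\<dots> = (LINT x|\<mu>. avg N (zext \<phi>) (target N x))"
    by (intro Bochner_Integration.integral_cong refl integral_pert_wmap[OF N _ \<phi>(1)]) (simp add: \<mu>'(3))
  finally show ?thesis .
qed

lemma integrable_zext_bounded:
  assumes "\<phi> \<in> borel_measurable leb" "\<And>x. x \<in> unit_ivl \<Longrightarrow> \<bar>\<phi> x\<bar> \<le> (B::real)"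
  shows "integrable lborel (zext \<phi>)"
proof -
  have "emeasure leb (space leb) < \<infinity>"
    by (simp add: emeasure_restrict_space space_restrict_space)
  then interpret finite_measure leb by (intro finite_measureI) auto
  have "integrable leb \<phi>"
    using assms by (intro integrable_const_bound[of _ B]) (auto simp: space_restrict_space)
  then show ?thesis by (simp add: integrable_leb)
qed

lemma avg_bounded:
  assumes N: "N > 0" and \<phi>: "\<phi> \<in> borel_measurable leb" "\<And>x. x \<in> unit_ivl \<Longrightarrow> \<bar>\<phi> x\<bar> \<le> B"
    and i: "i \<in> chain_states N"
  shows "\<bar>avg N (zext \<phi>) i\<bar> \<le> B"
proof -
  have "cell N i \<subseteq> unit_ivl" using i N by (intro cell_subset_unit) auto
  then have "\<bar>avg N (zext \<phi>) i - 0\<bar> \<le> B"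
    using \<phi> by (intro avg_close[OF N integrable_zext_bounded[OF \<phi>]]) auto
  then show ?thesis by simp
qed

lemma integral_evolve_target:
  fixes v :: "int \<Rightarrow> real"
  assumes N: "N > 0" and \<mu>: "\<mu> \<in> space (prob_algebra leb)"
    and v: "\<And>i. i \<in> chain_states N \<Longrightarrow> \<bar>v i\<bar> \<le> B"
  shows "(LINT x|evolve N \<mu>. v (target N x)) = (LINT x|\<mu>. chain N v (target N x))"
proof -
  have "(LINT x|evolve N \<mu>. v (target N x)) = (LINT x|\<mu>. avg N (zext (\<lambda>x. v (target N x))) (target N x))"
    by (rule integral_evolve[OF N \<mu> target_function_measurable v]) (rule target_states[OF N])
  also have "\<dots> = (LINT x|\<mu>. chain N v (target N x))"
    using target_states[OF N] prob_algebra_leb(3)[OF \<mu>]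
    by (intro Bochner_Integration.integral_cong refl avg_target[OF N]) auto
  finally show ?thesis .
qed

text \<open>Duality: for observables that depend on the point through \<open>target\<close>,
  evolving the measure amounts to iterating the transition operator.\<close>

lemma integral_evolve_pow_target:
  fixes v :: "int \<Rightarrow> real"
  assumes N: "N > 0" and \<mu>: "\<mu> \<in> space (prob_algebra leb)"
    and v: "\<And>i. i \<in> chain_states N \<Longrightarrow> \<bar>v i\<bar> \<le> B"
  shows "(LINT x|(evolve N ^^ n) \<mu>. v (target N x)) = (LINT x|\<mu>. (chain N ^^ n) v (target N x))"
  using v
proof (induction n arbitrary: v)
  case (Suc n)
  have v': "\<bar>chain N v i\<bar> \<le> B" if "i \<in> chain_states N" for i
    using chain_pow_bounded[OF N Suc.prems that, where n = 1] by simp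
  have "(LINT x|(evolve N ^^ Suc n) \<mu>. v (target N x)) = (LINT x|(evolve N ^^ n) \<mu>. chain N v (target N x))"
    unfolding funpow.simps comp_apply
    by (rule integral_evolve_target[OF N evolve_pow_prob[OF N \<mu>] Suc.prems])
  also have "\<dots> = (LINT x|\<mu>. (chain N ^^ n) (chain N v) (target N x))"
    by (rule Suc.IH[OF v'])
  finally show ?case by (simp only: funpow_Suc_right comp_apply)
qed simp

text \<open>Since \<open>pert N (1/3)\<close> is uniform on one of the two cells of the trap, one step produces the uniform
  distribution on the trap.\<close>

definition stationary :: "nat \<Rightarrow> real measure" where
  "stationary N = evolve N (pert N (1/3))"

lemma stationary_prob:
  assumes "N > 0"
  shows "stationary N \<in> space (prob_algebra leb)" "pert N (1/3) \<in> space (prob_algebra leb)"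
proof -
  show "pert N (1/3) \<in> space (prob_algebra leb)"
    using prob_space_pert[OF assms, of "1/3"] by (simp add: space_prob_algebra)
  then show "stationary N \<in> space (prob_algebra leb)"
    unfolding stationary_def by (rule evolve_prob[OF assms])
qed

lemma integral_pert_target:
  fixes v :: "int \<Rightarrow> real"
  assumes N: "N > 0"
  shows "(LINT x|pert N (1/3). v (target N x)) = (v (int N) + v (int N - 1)) / 2"
proof -
  have w: "wmap (1/3) = 1/3" by (simp add: wmap_def)
  have "(LINT x|pert N (1/3). v (target N x)) = avg N (zext (\<lambda>x. v (target N x))) (int N - 1)"
    using integral_pert_wmap[OF N _ target_function_measurable[of v N], of "1/3"]
    unfolding w target_turning_point[OF N] by simp
  also have "\<dots> = chain N v (int N - 1)" using N by (intro avg_target) auto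
  finally show ?thesis by (simp add: chain_def next_cell_def)
qed

lemma integral_stationary:
  fixes \<phi> :: "real \<Rightarrow> real"
  assumes N: "N > 0" and \<phi>: "\<phi> \<in> borel_measurable leb" "\<And>x. x \<in> unit_ivl \<Longrightarrow> \<bar>\<phi> x\<bar> \<le> B"
  shows "(LINT x|stationary N. \<phi> x) = (avg N (zext \<phi>) (int N) + avg N (zext \<phi>) (int N - 1)) / 2"
  using integral_evolve[OF N stationary_prob(2)[OF N] \<phi>] integral_pert_target[OF N, of "avg N (zext \<phi>)"]
  by (simp only: stationary_def)

section \<open>Invariance, attraction of all measures, and uniqueness\<close>

lemma prob_eqI:
  assumes \<mu>: "\<mu> \<in> space (prob_algebra leb)" and \<nu>: "\<nu> \<in> space (prob_algebra leb)"
    and eq: "\<And>A. A \<in> sets leb \<Longrightarrow> (LINT x|\<mu>. indicator A x) = (LINT x|\<nu>. indicator A x :: real)"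
  shows "\<mu> = \<nu>"
proof (rule measure_eqI)
  interpret M: prob_space \<mu> by (rule prob_algebra_leb(1)[OF \<mu>])
  interpret V: prob_space \<nu> by (rule prob_algebra_leb(1)[OF \<nu>])
  show "sets \<mu> = sets \<nu>" by (simp add: prob_algebra_leb[OF \<mu>] prob_algebra_leb[OF \<nu>])
  fix A assume "A \<in> sets \<mu>"
  then have A: "A \<in> sets leb" "A \<in> sets \<mu>" "A \<in> sets \<nu>"
    by (auto simp: prob_algebra_leb[OF \<mu>] prob_algebra_leb[OF \<nu>])
  have "measure \<mu> A = measure \<nu> A"
    using eq[OF A(1)] A sets.sets_into_space[OF A(2)] sets.sets_into_space[OF A(3)]
    by (simp add: Int_absorb2)
  then show "emeasure \<mu> A = emeasure \<nu> A"
    by (simp add: M.emeasure_eq_measure V.emeasure_eq_measure)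
qed

lemma stationary_invariant:
  assumes N: "N > 0"
  shows "evolve N (stationary N) = stationary N"
proof (rule prob_eqI[OF evolve_prob[OF N stationary_prob(1)[OF N]] stationary_prob(1)[OF N]])
  fix A assume A: "A \<in> sets leb"
  let ?\<phi> = "indicator A :: real \<Rightarrow> real"
  have \<phi>: "?\<phi> \<in> borel_measurable leb" "\<And>x. x \<in> unit_ivl \<Longrightarrow> \<bar>?\<phi> x\<bar> \<le> 1"
    using A by (auto simp: indicator_def)
  define v where "v = avg N (zext ?\<phi>)"
  have v: "\<bar>v i\<bar> \<le> 1" if "i \<in> chain_states N" for i
    unfolding v_def by (rule avg_bounded[OF N \<phi> that])
  have "(LINT x|evolve N (stationary N). ?\<phi> x) = (LINT x|stationary N. v (target N x))"
    unfolding v_def by (rule integral_evolve[OF N stationary_prob(1)[OF N] \<phi>])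
  also have "\<dots> = (LINT x|pert N (1/3). chain N v (target N x))"
    unfolding stationary_def by (rule integral_evolve_target[OF N stationary_prob(2)[OF N] v])
  also have "\<dots> = (v (int N) + v (int N - 1)) / 2"
    unfolding integral_pert_target[OF N] using N by (simp add: chain_def next_cell_def)
  also have "\<dots> = (LINT x|stationary N. ?\<phi> x)"
    unfolding v_def by (rule integral_stationary[OF N \<phi>, symmetric])
  finally show "(LINT x|evolve N (stationary N). ?\<phi> x) = (LINT x|stationary N. ?\<phi> x)" .
qed

lemma evolve_converges:
  fixes \<phi> :: "real \<Rightarrow> real"
  assumes N: "N = 2 ^ m" and \<mu>: "\<mu> \<in> space (prob_algebra leb)"
    and \<phi>: "\<phi> \<in> borel_measurable leb" "\<And>x. x \<in> unit_ivl \<Longrightarrow> \<bar>\<phi> x\<bar> \<le> B"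
  shows "(\<lambda>n. LINT x|(evolve N ^^ n) \<mu>. \<phi> x) \<longlonglongrightarrow> (LINT x|stationary N. \<phi> x)"
proof (rule LIMSEQ_imp_Suc, rule LIMSEQ_I)
  fix r :: real assume r: "r > 0"
  have N0: "N > 0" using N by simp
  interpret prob_space \<mu> by (rule prob_algebra_leb(1)[OF \<mu>])
  define v where "v = avg N (zext \<phi>)"
  have v: "\<bar>v i\<bar> \<le> B" if "i \<in> chain_states N" for i
    unfolding v_def by (rule avg_bounded[OF N0 \<phi> that])
  define \<rho> where "\<rho> = (v (int N) + v (int N - 1)) / 2"
  have "\<exists>n0. \<forall>n\<ge>n0. \<forall>i\<in>chain_states N. \<bar>(chain N ^^ n) v i - \<rho>\<bar> \<le> r / 2"
    unfolding \<rho>_def by (rule chain_pow_converges[where v = v, OF N v]) (use r in auto)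
  then obtain n0 where n0: "\<forall>n\<ge>n0. \<forall>i\<in>chain_states N. \<bar>(chain N ^^ n) v i - \<rho>\<bar> \<le> r / 2" ..
  have "norm ((LINT x|(evolve N ^^ Suc n) \<mu>. \<phi> x) - (LINT x|stationary N. \<phi> x)) < r" if n: "n \<ge> n0" for n
  proof -
    have [measurable]: "(\<lambda>x. w (target N x)) \<in> borel_measurable \<mu>" for w :: "int \<Rightarrow> real"
      using target_function_measurable measurable_cong_sets[OF prob_algebra_leb(2)[OF \<mu>] refl] by blast
    have bound: "\<bar>(chain N ^^ n) v (target N x) - \<rho>\<bar> \<le> r / 2" if "x \<in> space \<mu>" for x
      using n0 n target_states[OF N0] that prob_algebra_leb(3)[OF \<mu>] by auto
    have i: "integrable \<mu> (\<lambda>x. (chain N ^^ n) v (target N x) - \<rho>)"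
      by (rule integrable_const_bound[of _ "r / 2"])
        (use bound in \<open>auto intro!: borel_measurable_diff\<close>)
    have "(LINT x|(evolve N ^^ Suc n) \<mu>. \<phi> x) = (LINT x|(evolve N ^^ n) \<mu>. v (target N x))"
      unfolding funpow.simps comp_apply v_def
      by (rule integral_evolve[OF N0 evolve_pow_prob[OF N0 \<mu>] \<phi>])
    also have "\<dots> = (LINT x|\<mu>. (chain N ^^ n) v (target N x))"
      by (rule integral_evolve_pow_target[OF N0 \<mu> v])
    also have "\<dots> = (LINT x|\<mu>. ((chain N ^^ n) v (target N x) - \<rho>) + \<rho>)" by simp
    also have "\<dots> = (LINT x|\<mu>. (chain N ^^ n) v (target N x) - \<rho>) + \<rho>"
      using i by (subst Bochner_Integration.integral_add) (auto simp: prob_space)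
    finally have "(LINT x|(evolve N ^^ Suc n) \<mu>. \<phi> x) - \<rho> = (LINT x|\<mu>. (chain N ^^ n) v (target N x) - \<rho>)"
      by simp
    moreover have "\<bar>LINT x|\<mu>. (chain N ^^ n) v (target N x) - \<rho>\<bar> \<le> r / 2"
    proof -
      have "\<bar>LINT x|\<mu>. (chain N ^^ n) v (target N x) - \<rho>\<bar> \<le> (LINT x|\<mu>. \<bar>(chain N ^^ n) v (target N x) - \<rho>\<bar>)"
        by (rule integral_abs_bound)
      also have "\<dots> \<le> (LINT x|\<mu>. r / 2)"
        using i bound by (intro integral_mono) auto
      finally show ?thesis by (simp add: prob_space)
    qed
    moreover have "(LINT x|stationary N. \<phi> x) = \<rho>"
      unfolding \<rho>_def v_def by (rule integral_stationary[OF N0 \<phi>])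
    ultimately show ?thesis using r by simp
  qed
  then show "\<exists>no. \<forall>n\<ge>no. norm ((LINT x|(evolve N ^^ Suc n) \<mu>. \<phi> x) - (LINT x|stationary N. \<phi> x)) < r"
    by blast
qed

lemma continuous_on_unit_bounded:
  fixes \<phi> :: "real \<Rightarrow> real"
  assumes "continuous_on unit_ivl \<phi>"
  shows "\<phi> \<in> borel_measurable leb" "\<exists>B. \<forall>x\<in>unit_ivl. \<bar>\<phi> x\<bar> \<le> B"
proof -
  have "\<phi> \<in> borel_measurable (restrict_space borel unit_ivl)"
    using assms by (rule borel_measurable_continuous_on_restrict)
  then show "\<phi> \<in> borel_measurable leb"
    by (simp add: measurable_def sets_restrict_space space_restrict_space)
  have "bounded (\<phi> ` unit_ivl)"
    using assms by (intro compact_imp_bounded compact_continuous_image) auto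
  then show "\<exists>B. \<forall>x\<in>unit_ivl. \<bar>\<phi> x\<bar> \<le> B" by (auto simp: bounded_iff)
qed

lemma SBR_stationary:
  assumes N: "N = 2 ^ m"
  shows "invariant_SBR_measure wmap (pert N) (stationary N)"
  unfolding invariant_SBR_measure_def SBR_measure_def
\<comment> \<open>The basin is the whole interval.\<close>
proof (intro conjI exI[of _ unit_ivl] ballI impI)
  have N0: "N > 0" using N by simp
  show "stationary N \<in> space (prob_algebra leb)" by (rule stationary_prob(1)[OF N0])
  show "evolve N (stationary N) = stationary N" by (rule stationary_invariant[OF N0])
  fix \<mu> assume \<mu>: "\<mu> \<in> space (prob_algebra leb)"
  show "weakly_tendsto (\<lambda>n. (evolve N ^^ n) \<mu>) (stationary N) sequentially"
    unfolding weakly_tendsto_def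
  proof (intro allI impI)
    fix \<phi> :: "real \<Rightarrow> real" assume c: "continuous_on unit_ivl \<phi>"
    obtain B where "\<And>x. x \<in> unit_ivl \<Longrightarrow> \<bar>\<phi> x\<bar> \<le> B" using continuous_on_unit_bounded(2)[OF c] by blast
    then show "(\<lambda>n. LINT x|(evolve N ^^ n) \<mu>. \<phi> x) \<longlonglongrightarrow> (LINT x|stationary N. \<phi> x)"
      by (rule evolve_converges[OF N \<mu> continuous_on_unit_bounded(1)[OF c]])
  qed
qed auto

text \<open>The evolution of an invariant measure is a constant sequence, yet its integrals of
  indicators converge to those of \<open>stationary N\<close>.\<close>

lemma invariant_unique:
  assumes N: "N = 2 ^ m" and \<nu>: "\<nu> \<in> space (prob_algebra leb)" "evolve N \<nu> = \<nu>"
  shows "\<nu> = stationary N"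
proof (rule prob_eqI[OF \<nu>(1) stationary_prob(1)])
  show "N > 0" using N by simp
  fix A assume "A \<in> sets leb"
  then have "(\<lambda>n. LINT x|(evolve N ^^ n) \<nu>. indicator A x :: real) \<longlonglongrightarrow> (LINT x|stationary N. indicator A x)"
    by (intro evolve_converges[OF N \<nu>(1), where B = 1]) (auto simp: indicator_def)
  moreover have "(evolve N ^^ n) \<nu> = \<nu>" for n by (induction n) (simp_all add: \<nu>(2))
  ultimately show "(LINT x|\<nu>. indicator A x) = (LINT x|stationary N. indicator A x :: real)"
    by (simp add: LIMSEQ_const_iff)
qed

section \<open>The zero-noise limit and the choice of the grid\<close>

lemma stationary_tendsto:
  "weakly_tendsto stationary turning_delta sequentially"
  unfolding weakly_tendsto_def
proof (intro allI impI LIMSEQ_I)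
  fix \<phi> :: "real \<Rightarrow> real" and r :: real assume c: "continuous_on unit_ivl \<phi>" and r: "r > 0"
  note m = continuous_on_unit_bounded(1)[OF c]
  obtain B where B: "\<And>x. x \<in> unit_ivl \<Longrightarrow> \<bar>\<phi> x\<bar> \<le> B" using continuous_on_unit_bounded(2)[OF c] by blast
  have "(1/3::real) \<in> unit_ivl" by simp
  with c r obtain d where d: "d > 0" "\<And>x. x \<in> unit_ivl \<Longrightarrow> dist x (1/3) < d \<Longrightarrow> dist (\<phi> x) (\<phi> (1/3)) < r / 2"
    unfolding continuous_on_iff by (metis half_gt_zero)
  obtain N0 where N0: "1 / d < real N0" using reals_Archimedean2 by blast
  have delta: "(LINT x|turning_delta. \<phi> x) = \<phi> (1/3)"
    using m by (subst integral_return) (auto simp: space_restrict_space)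
  have "norm ((LINT x|stationary N. \<phi> x) - (LINT x|turning_delta. \<phi> x)) < r" if N: "N \<ge> max 1 N0" for N
  proof -
    have N1: "N > 0" using N by simp
    have "1 / d < real N" using N0 N by linarith
    then have Nd: "1 / real N < d" using N1 d(1) by (simp add: field_simps)
    have close: "\<bar>avg N (zext \<phi>) i - \<phi> (1/3)\<bar> \<le> r / 2" if i: "i = int N \<or> i = int N - 1" for i
    proof (rule avg_close[OF N1 integrable_zext_bounded[OF m B]])
      fix y assume y: "y \<in> cell N i"
      have "cell N i \<subseteq> unit_ivl" by (rule cell_subset_unit[OF N1]) (use i N1 in auto)
      then have u: "y \<in> unit_ivl" using y by blast
      have "real N - 1 \<le> 3 * real N * y" "3 * real N * y \<le> real N + 1"
        using y i unfolding cell_def mem_Collect_eq floor_eq_iff by auto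
      then have "\<bar>3 * real N * (y - 1/3)\<bar> \<le> 1" by (simp add: right_diff_distrib abs_le_iff)
      then have "3 * real N * \<bar>y - 1/3\<bar> \<le> 1" by (simp add: abs_mult)
      moreover have "real N * \<bar>y - 1/3\<bar> \<le> 3 * real N * \<bar>y - 1/3\<bar>" by simp
      ultimately have "real N * \<bar>y - 1/3\<bar> \<le> 1" by linarith
      then have "\<bar>y - 1/3\<bar> \<le> 1 / real N" using N1 by (simp add: field_simps)
      then have "dist y (1/3) < d" using Nd by (simp add: dist_real_def)
      from d(2)[OF u this] show "\<bar>zext \<phi> y - \<phi> (1/3)\<bar> \<le> r / 2"
        using u by (simp add: dist_real_def)
    qed
    have "\<bar>(avg N (zext \<phi>) (int N) + avg N (zext \<phi>) (int N - 1)) - 2 * \<phi> (1/3)\<bar> \<le> r"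
      using close[of "int N"] close[of "int N - 1"] by linarith
    then have "\<bar>((avg N (zext \<phi>) (int N) + avg N (zext \<phi>) (int N - 1)) - 2 * \<phi> (1/3)) / 2\<bar> \<le> r / 2"
      by simp
    then have "\<bar>(avg N (zext \<phi>) (int N) + avg N (zext \<phi>) (int N - 1)) / 2 - \<phi> (1/3)\<bar> \<le> r / 2"
      by (simp add: diff_divide_distrib)
    moreover have "(LINT x|stationary N. \<phi> x) = (avg N (zext \<phi>) (int N) + avg N (zext \<phi>) (int N - 1)) / 2"
      by (rule integral_stationary[OF N1 m B])
    ultimately have "\<bar>(LINT x|stationary N. \<phi> x) - \<phi> (1/3)\<bar> \<le> r / 2" by (simp only:)
    then show ?thesis unfolding delta using r by simp
  qed
  then show "\<exists>no. \<forall>N\<ge>no. norm ((LINT x|stationary N. \<phi> x) - (LINT x|turning_delta. \<phi> x)) < r"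
    by blast
qed

text \<open>For \<epsilon> > 0 this is the least power of two, with natural exponent, that is at
  least 1 / \<epsilon>; truncation by \<open>nat\<close> gives 1 when \<epsilon> > 1.\<close>

definition grid_size :: "real \<Rightarrow> nat" where
  "grid_size \<epsilon> = 2 ^ nat \<lceil>log 2 (1 / \<epsilon>)\<rceil>"

lemma grid_size_pos: "grid_size \<epsilon> > 0"
  by (simp add: grid_size_def)

lemma grid_size_ge:
  assumes "\<epsilon> > 0"
  shows "1 / \<epsilon> \<le> real (grid_size \<epsilon>)"
proof -
  have "1 / \<epsilon> = 2 powr log 2 (1 / \<epsilon>)" using assms by simp
  also have "\<dots> \<le> 2 powr real (nat \<lceil>log 2 (1 / \<epsilon>)\<rceil>)"
    by (intro powr_mono) (linarith, simp)
  finally show ?thesis by (simp add: grid_size_def powr_realpow)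
qed

lemma grid_size_at_top: "filterlim grid_size at_top (at_right 0)"
proof -
  have "filterlim (\<lambda>\<epsilon>::real. 1 / \<epsilon>) at_top (at_right 0)" by real_asymp
  then have "filterlim (\<lambda>\<epsilon>. real (grid_size \<epsilon>)) at_top (at_right 0)"
    by (rule filterlim_at_top_mono)
      (auto simp: eventually_at_right_field grid_size_ge intro!: exI[of _ 1])
  then show ?thesis
    unfolding filterlim_at_top by (metis (mono_tags, lifting) eventually_mono of_nat_le_iff)
qed

lemma small_pert: "small_perturbation (\<lambda>\<epsilon>. pert (grid_size \<epsilon>))"
  unfolding small_perturbation_def
proof (intro allI impI)
  fix h :: "real \<Rightarrow> real" assume h: "integrable leb h"
  have "((\<lambda>\<epsilon>. step_error (grid_size \<epsilon>) (zext h)) \<longlongrightarrow> 0) (at_right 0)"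
    using well_approximated_integrable[OF h] unfolding well_approximated_def
    by (rule filterlim_compose[OF _ grid_size_at_top])
  then show "((\<lambda>\<epsilon>. norm1 (\<lambda>x. kernel_op (pert (grid_size \<epsilon>)) h x - h x)) \<longlongrightarrow> 0) (at_right 0)"
    by (simp only: norm1_kernel_op_diff[OF grid_size_pos h] step_error_def)
qed

lemma local_pert: "local_perturbation (\<lambda>\<epsilon>. pert (grid_size \<epsilon>))"
  unfolding local_perturbation_def
proof (intro allI ballI impI)
  fix \<epsilon> x :: real and A
  assume \<epsilon>: "\<epsilon> > 0" and A: "A \<in> sets leb" "infdist x A > \<epsilon>"
  \<comment> \<open>Two cell lengths amount to at most 2/3 of \<epsilon>.\<close>
  have "2 / (3 * real (grid_size \<epsilon>)) \<le> \<epsilon>"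
  proof -
    have "1 \<le> \<epsilon> * real (grid_size \<epsilon>)" using grid_size_ge[OF \<epsilon>] \<epsilon> by (simp add: field_simps)
    then show ?thesis using grid_size_pos[of \<epsilon>] by (simp add: field_simps)
  qed
  then show "emeasure (pert (grid_size \<epsilon>) x) A = 0"
    by (rule emeasure_pert_distant[OF grid_size_pos _ A])
qed

lemma regular_pert: "regular_perturbation (\<lambda>\<epsilon>. pert (grid_size \<epsilon>))"
  unfolding regular_perturbation_def
  by (intro exI[of _ 12]) (auto intro: var_kernel_op_le grid_size_pos)

theorem theorem1p3:
  shows "\<exists>(f :: real \<Rightarrow> real) (Q :: real \<Rightarrow> real \<Rightarrow> real measure)
          (\<mu>\<^sub>\<epsilon> :: real \<Rightarrow> real measure) (\<mu> :: real measure).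
      H1 f \<and> (\<exists>c. periodic_turning_point f c) \<and>
      (\<forall>\<epsilon>>0. transition_prob (Q \<epsilon>) \<and> smooth_kernel (Q \<epsilon>)) \<and>
      small_perturbation Q \<and> local_perturbation Q \<and> regular_perturbation Q \<and>
      (\<exists>\<epsilon>\<^sub>0>0. \<forall>\<epsilon>. 0 < \<epsilon> \<and> \<epsilon> < \<epsilon>\<^sub>0 \<longrightarrow>
         invariant_SBR_measure f (Q \<epsilon>) (\<mu>\<^sub>\<epsilon> \<epsilon>) \<and>
         (\<forall>\<nu>. invariant_SBR_measure f (Q \<epsilon>) \<nu> \<longrightarrow> \<nu> = \<mu>\<^sub>\<epsilon> \<epsilon>)) \<and>
      weakly_tendsto \<mu>\<^sub>\<epsilon> \<mu> (at_right 0) \<and>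
      invariant_measure f \<mu> \<and> singular_measure \<mu> \<and> unstable_measure f \<mu>"
proof (intro exI conjI)
  show "H1 wmap" by (rule H1_wmap)
  show "periodic_turning_point wmap (1/3)" by (rule periodic_turning_point_wmap)
  show "\<forall>\<epsilon>>0. transition_prob (pert (grid_size \<epsilon>)) \<and> smooth_kernel (pert (grid_size \<epsilon>))"
    by (simp add: transition_prob_pert smooth_kernel_pert grid_size_pos)
  show "small_perturbation (\<lambda>\<epsilon>. pert (grid_size \<epsilon>))" by (rule small_pert)
  show "local_perturbation (\<lambda>\<epsilon>. pert (grid_size \<epsilon>))" by (rule local_pert)
  show "regular_perturbation (\<lambda>\<epsilon>. pert (grid_size \<epsilon>))" by (rule regular_pert)
  show "(0::real) < 1" by simp
  show "\<forall>\<epsilon>. 0 < \<epsilon> \<and> \<epsilon> < 1 \<longrightarrow>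
      invariant_SBR_measure wmap (pert (grid_size \<epsilon>)) (stationary (grid_size \<epsilon>)) \<and>
      (\<forall>\<nu>. invariant_SBR_measure wmap (pert (grid_size \<epsilon>)) \<nu> \<longrightarrow> \<nu> = stationary (grid_size \<epsilon>))"
    using SBR_stationary[OF grid_size_def] invariant_unique[OF grid_size_def]
    by (auto simp: invariant_SBR_measure_def SBR_measure_def)
  show "weakly_tendsto (\<lambda>\<epsilon>. stationary (grid_size \<epsilon>)) turning_delta (at_right 0)"
    using stationary_tendsto unfolding weakly_tendsto_def
    by (auto intro: filterlim_compose[OF _ grid_size_at_top])
  show "invariant_measure wmap turning_delta" by (rule invariant_turning_delta)
  show "singular_measure turning_delta" by (rule singular_turning_delta)
  show "unstable_measure wmap turning_delta" by (rule unstable_turning_delta)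
qed

end
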